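(* Let $H$ be a graph isomorphic to an induced subgraph of $Q_k$ for some $k$. Then for all sufficiently large $n$, the vertex set of $(P_{2|H|})^n$ can be partitioned into sets each inducing a copy of $H$, i.e. $(P_{2|H|})^n$ has a perfect packing by induced copies of $H$.
   Context: $Q_k$ is the $k$-dimensional hypercube on $\{0,1\}^k$. $P_m$ is the path on $m$ vertices and $|H|$ is the number of vertices of $H$. For graphs $G_1,G_2$ the Cartesian product $G_1\times G_2$ has vertex set $V(G_1)\times V(G_2)$, with $(u_1,u_2)\sim(v_1,v_2)$ iff either $u_1=v_1$ and $u_2v_2\in E(G_2)$, or $u_2=v_2$ and $u_1v_1\in E(G_1)$; $G^n$ is the product of $n$ copies of $G$. An induced copy of $H$ is an induced subgraph isomorphic to $H$. *)

theory Defs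
  imports "Graph_Theory.Graph_Theory" "HOL-Library.Disjoint_Sets"
begin

text \<open>
  Finite simple graphs are symmetric loop-free digraphs without parallel arcs
  (locale \<open>graph\<close>): an edge is a pair of opposite arcs.
\<close>

definition path_graph :: "nat \<Rightarrow> nat pair_pre_digraph" where
  "path_graph m = \<lparr> pverts = {..<m},
     parcs = {(i, j). i < m \<and> j < m \<and> (j = Suc i \<or> i = Suc j)} \<rparr>"

definition hypercube :: "nat \<Rightarrow> nat list pair_pre_digraph" where
  "hypercube k = \<lparr> pverts = {xs. length xs = k \<and> set xs \<subseteq> {0, 1}},
     parcs = {(xs, ys). length xs = k \<and> set xs \<subseteq> {0, 1} \<and> length ys = k \<and> set ys \<subseteq> {0, 1} \<and>
                (\<exists>!i. i < k \<and> xs ! i \<noteq> ys ! i)} \<rparr>"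

definition cart_prod :: "'a pair_pre_digraph \<Rightarrow> 'b pair_pre_digraph \<Rightarrow> ('a \<times> 'b) pair_pre_digraph" where
  "cart_prod G1 G2 = \<lparr> pverts = pverts G1 \<times> pverts G2,
     parcs = {((u1, u2), (v1, v2)).
                u1 \<in> pverts G1 \<and> v1 \<in> pverts G1 \<and> u2 \<in> pverts G2 \<and> v2 \<in> pverts G2 \<and>
                (u1 = v1 \<and> (u2, v2) \<in> parcs G2 \<or> u2 = v2 \<and> (u1, v1) \<in> parcs G1)} \<rparr>"

definition map_pair_digraph :: "('a \<Rightarrow> 'b) \<Rightarrow> 'a pair_pre_digraph \<Rightarrow> 'b pair_pre_digraph" where
  "map_pair_digraph f G = \<lparr> pverts = f ` pverts G, parcs = map_prod f f ` parcs G \<rparr>"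

text \<open>
  The iterated product \<open>G \<times> (G \<times> (\<dots>))\<close>, with vertex tuples encoded as lists so that all powers
  of \<open>G\<close> have the same type. The zeroth power is the one-vertex graph.
\<close>

primrec cart_power :: "'a pair_pre_digraph \<Rightarrow> nat \<Rightarrow> 'a list pair_pre_digraph" where
  "cart_power G 0 = \<lparr> pverts = {[]}, parcs = {} \<rparr>"
| "cart_power G (Suc n) = map_pair_digraph (\<lambda>(x, xs). x # xs) (cart_prod G (cart_power G n))"

definition has_perfect_induced_packing :: "('a, 'b) pre_digraph \<Rightarrow> ('c, 'd) pre_digraph \<Rightarrow> bool" where
  "has_perfect_induced_packing H G \<longleftrightarrow>
     (\<exists>P. partition_on (verts G) P \<and> (\<forall>S\<in>P. digraph_iso H (G \<restriction> S)))"

lemma pverts_cart_power: "pverts (cart_power G n) = {xs. length xs = n \<and> set xs \<subseteq> pverts G}"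
  by (induction n)
    (force simp: map_pair_digraph_def cart_prod_def length_Suc_conv image_iff)+

lemma parcs_cart_power_Suc:
  "(x # xs, y # ys) \<in> parcs (cart_power G (Suc n)) \<longleftrightarrow>
     x \<in> pverts G \<and> y \<in> pverts G \<and> xs \<in> pverts (cart_power G n) \<and> ys \<in> pverts (cart_power G n) \<and>
     (x = y \<and> (xs, ys) \<in> parcs (cart_power G n) \<or> xs = ys \<and> (x, y) \<in> parcs G)"
  by (force simp: map_pair_digraph_def cart_prod_def image_iff)

lemma pair_graph_path_graph: "pair_graph (path_graph m)"
proof -
  have "finite (parcs (path_graph m))"
    by (rule finite_subset[of _ "{..<m} \<times> {..<m}"]) (auto simp: path_graph_def)
  then show ?thesis
    by unfold_locales (auto simp: path_graph_def symmetric_def sym_def)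
qed

lemma pair_graph_cart_prod:
  assumes "pair_graph G1" "pair_graph G2"
  shows "pair_graph (cart_prod G1 G2)"
proof -
  interpret G1: pair_graph G1 by fact
  interpret G2: pair_graph G2 by fact
  have "finite (parcs (cart_prod G1 G2))"
    by (rule finite_subset[of _ "(pverts G1 \<times> pverts G2) \<times> (pverts G1 \<times> pverts G2)"])
      (auto simp: cart_prod_def)
  then show ?thesis
    by unfold_locales
      (auto simp: cart_prod_def symmetric_def sym_def
        dest: G1.arcs_symmetric G2.arcs_symmetric G1.no_loops' G2.no_loops')
qed

lemma pair_graph_map_pair_digraph:
  assumes "pair_graph G" "inj f"
  shows "pair_graph (map_pair_digraph f G)"
proof -
  interpret pair_graph G by fact
  show ?thesis
  proof unfold_locales
    show "symmetric (with_proj (map_pair_digraph f G))"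
      by (auto simp: map_pair_digraph_def symmetric_def intro!: symI imageI
          intro: rev_image_eqI dest: arcs_symmetric)
  qed (use assms(2) in \<open>auto simp: map_pair_digraph_def inj_eq wellformed' dest: no_loops'\<close>)
qed

lemma pair_graph_cart_power:
  assumes "pair_graph G"
  shows "pair_graph (cart_power G n)"
proof (induction n)
  case 0
  show ?case by unfold_locales (auto simp: symmetric_def)
next
  case (Suc n)
  then show ?case
    by (auto intro!: pair_graph_map_pair_digraph pair_graph_cart_prod assms injI)
qed

lemma cart_power_path_graph_2: "cart_power (path_graph 2) k = hypercube k"
proof -
  have V: "pverts (cart_power (path_graph 2) n) = pverts (hypercube n)" for n
    by (auto simp: pverts_cart_power hypercube_def path_graph_def subset_iff less_2_cases_iff)
  have "(xs, ys) \<in> parcs (cart_power (path_graph 2) k) \<longleftrightarrow> (xs, ys) \<in> parcs (hypercube k)" for xs ys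
  proof (induction k arbitrary: xs ys)
    case 0
    show ?case by (auto simp: hypercube_def)
  next
    case (Suc k)
    show ?case
    proof (cases "xs \<in> pverts (hypercube (Suc k)) \<and> ys \<in> pverts (hypercube (Suc k))")
      case False
      interpret pair_graph "cart_power (path_graph 2) (Suc k)"
        by (rule pair_graph_cart_power[OF pair_graph_path_graph])
      have "(xs, ys) \<notin> parcs (cart_power (path_graph 2) (Suc k))"
        using False in_arcsD1 in_arcsD2 unfolding V by blast
      moreover have "(xs, ys) \<notin> parcs (hypercube (Suc k))"
        using False by (auto simp: hypercube_def)
      ultimately show ?thesis by simp
    next
      case True
      then obtain x xs' y ys' where eq: "xs = x # xs'" "ys = y # ys'"
        and mem: "xs' \<in> pverts (hypercube k)" "ys' \<in> pverts (hypercube k)"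
          "x \<in> {0, 1}" "y \<in> {0, 1}"
        by (auto simp: hypercube_def length_Suc_conv)
      have ex: "(\<exists>!i. i < Suc k \<and> (x # xs') ! i \<noteq> (y # ys') ! i) \<longleftrightarrow>
        x = y \<and> (\<exists>!i. i < k \<and> xs' ! i \<noteq> ys' ! i) \<or> x \<noteq> y \<and> (\<forall>i<k. xs' ! i = ys' ! i)"
        (is "(\<exists>!i. ?P i) \<longleftrightarrow> _")
      proof (cases "x = y")
        case True
        then have "?P i \<longleftrightarrow> (\<exists>j. i = Suc j \<and> j < k \<and> xs' ! j \<noteq> ys' ! j)" for i
          by (cases i) auto
        then show ?thesis using True by (simp add: Ex1_def) blast
      next
        case False
        then have "?P 0" by simp
        then have "(\<exists>!i. ?P i) \<longleftrightarrow> (\<forall>i. ?P i \<longrightarrow> i = 0)" by metis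
        also have "\<dots> \<longleftrightarrow> (\<forall>j. \<not> ?P (Suc j))"
          by (metis nat.exhaust nat.distinct(1))
        also have "\<dots> \<longleftrightarrow> (\<forall>i<k. xs' ! i = ys' ! i)"
          by simp
        finally show ?thesis using False by simp
      qed
      have "xs' = ys' \<longleftrightarrow> (\<forall>i<k. xs' ! i = ys' ! i)"
        using mem by (auto simp: hypercube_def intro: nth_equalityI)
      moreover have "(x, y) \<in> parcs (path_graph 2) \<longleftrightarrow> x \<noteq> y" "x \<in> pverts (path_graph 2)"
        "y \<in> pverts (path_graph 2)"
        using mem by (auto simp: path_graph_def)
      moreover have "(xs', ys') \<in> parcs (hypercube k) \<longleftrightarrow> (\<exists>!i. i < k \<and> xs' ! i \<noteq> ys' ! i)"
        using mem by (auto simp: hypercube_def)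
      moreover have "(xs, ys) \<in> parcs (hypercube (Suc k)) \<longleftrightarrow>
          (\<exists>!i. i < Suc k \<and> xs ! i \<noteq> ys ! i)"
        using True by (auto simp: hypercube_def)
      ultimately show ?thesis
        unfolding eq parcs_cart_power_Suc Suc.IH V ex using mem by auto
    qed
  qed
  then show ?thesis using V[of k] by (intro pair_pre_digraph.equality) auto
qed

end

theory Submission
  imports Defs
begin

text \<open>
  Let \<open>h\<close> be the number of vertices of \<open>H\<close>, call the induced copies of \<open>H\<close> tiles, and regard vertices
  of powers of the path \<open>P\<close> as words, so that products become concatenations.

  \<^item> On a power of \<open>P\<close> of large enough dimension \<open>k\<close>, the constant \<open>h\<close> is a sum of indicators of
    tiles (all reflections of one copy, in each cube of a partition into cubes). The constant \<open>1\<close>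
    is an integer combination of tiles modulo \<open>h\<close>: if a copy of \<open>H\<close> splits along a coordinate into
    \<open>H\<^sub>0\<close> and \<open>H\<^sub>1\<close>, then placing that coordinate on the edges \<open>{j, j+1}\<close> and \<open>{j+1, j+2}\<close> shows that
    \<open>{j} \<times> H\<^sub>0\<close> and \<open>{j+2} \<times> H\<^sub>0\<close> are congruent, and as there are \<open>h\<close> positions of each parity,
    \<open>P \<times> H\<^sub>0\<close> is congruent to \<open>0\<close>; iterate over the coordinates. Multiplying both facts makes \<open>1\<close> an
    integer combination of tiles in dimension \<open>2k\<close>.

  \<^item> Such a combination \<open>\<Sum> P\<^sub>i - \<Sum> N\<^sub>j = 1\<close> on \<open>\<Sigma>\<close> yields an honest tiling of \<open>X \<times> \<Sigma>\<close> if \<open>X\<close> contains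
    disjoint sets \<open>e\<^sub>i\<close>, \<open>f\<^sub>j\<close> such that \<open>X\<close> minus any \<open>r + 1\<close> of the \<open>e\<^sub>i\<close> and any \<open>r\<close> of the \<open>f\<^sub>j\<close> can be
    tiled: use \<open>e\<^sub>i \<times> P\<^sub>i\<close> and \<open>f\<^sub>j \<times> N\<^sub>j\<close>, and tile the rest in each fibre \<open>X \<times> {\<sigma>}\<close>.

  \<^item> If \<open>A\<close> and \<open>G\<close> can be tiled, then a high power of \<open>A \<union> G\<close> contains many such sets. Hence tiles can
    be absorbed one by one: if a product of copies of \<open>D\<close> and \<open>\<Sigma>\<close> can be tiled, then the same
    product with \<open>D \<union> T\<close> in place of \<open>D\<close> is a union of two sets that can be tiled, and therefore
    some longer product of copies of \<open>D \<union> T\<close> and \<open>\<Sigma>\<close> can be tiled. Starting from the empty set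
    this ends with \<open>D = \<Sigma>\<close>.
\<close>

section \<open>Tilings of sets of words\<close>

definition words :: "'a set \<Rightarrow> nat \<Rightarrow> 'a list set" where
  "words V n = {w. length w = n \<and> set w \<subseteq> V}"

definition conc :: "'a list set \<Rightarrow> 'a list set \<Rightarrow> 'a list set" where
  "conc A B = (\<lambda>(x, y). x @ y) ` (A \<times> B)"

lemma in_conc: "w \<in> conc A B \<longleftrightarrow> (\<exists>x\<in>A. \<exists>y\<in>B. w = x @ y)"
  by (auto simp: conc_def)

lemma concI: "x \<in> A \<Longrightarrow> y \<in> B \<Longrightarrow> x @ y \<in> conc A B"
  by (auto simp: conc_def)

lemma words_0 [simp]: "words V 0 = {[]}"
  by (auto simp: words_def)

lemma finite_words: "finite V \<Longrightarrow> finite (words V n)"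
  unfolding words_def using finite_lists_length_eq[of V n] by (simp add: conj_commute)

lemma words_in_lists: "w \<in> words V n \<Longrightarrow> w \<in> lists V"
  by (auto simp: words_def)

text \<open>A fixed prefix length makes the splitting unique, so disjointness and differences of
  concatenations can be computed on Cartesian products.\<close>

lemma inj_on_append: "inj_on (\<lambda>(x, y). x @ y) (words V m \<times> UNIV)"
  by (auto simp: inj_on_def words_def)

lemma conc_assoc: "conc (conc A B) C = conc A (conc B C)"
proof (intro equalityI subsetI)
  fix w assume "w \<in> conc (conc A B) C"
  then obtain x y z where "x \<in> A" "y \<in> B" "z \<in> C" "w = x @ y @ z"
    by (auto simp: conc_def)
  then show "w \<in> conc A (conc B C)" by (simp add: concI)
next
  fix w assume "w \<in> conc A (conc B C)"
  then obtain x y z where "x \<in> A" "y \<in> B" "z \<in> C" "w = (x @ y) @ z"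
    by (auto simp: conc_def)
  then show "w \<in> conc (conc A B) C" by (simp only: concI)
qed

lemma conc_Nil [simp]: "conc A {[]} = A" "conc {[]} A = A"
  by (simp_all add: set_eq_iff in_conc)

lemma conc_UN_right: "conc A (\<Union>i\<in>I. B i) = (\<Union>i\<in>I. conc A (B i))"
  and conc_Un_right: "conc A (D \<union> C) = conc A D \<union> conc A C"
  and conc_empty_right [simp]: "conc A {} = {}"
  by (auto simp: conc_def)

lemma conc_mono: "A \<subseteq> A' \<Longrightarrow> B \<subseteq> B' \<Longrightarrow> conc A B \<subseteq> conc A' B'"
  by (auto simp: conc_def)

lemma conc_words: "conc (words V m) (words V n) = words V (m + n)"
proof
  show "words V (m + n) \<subseteq> conc (words V m) (words V n)"
  proof
    fix w assume "w \<in> words V (m + n)"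
    then have "take m w \<in> words V m" "drop m w \<in> words V n"
      by (auto simp: words_def dest: in_set_takeD in_set_dropD)
    then show "w \<in> conc (words V m) (words V n)"
      unfolding conc_def by (rule_tac image_eqI[of _ _ "(take m w, drop m w)"]) auto
  qed
qed (auto simp: conc_def words_def)

lemma conc_subset_words: "A \<subseteq> words V m \<Longrightarrow> B \<subseteq> words V n \<Longrightarrow> conc A B \<subseteq> words V (m + n)"
  using conc_mono[of A "words V m" B "words V n"] by (simp add: conc_words)

section \<open>Tileable sets and their products\<close>

locale tiling =
  fixes V :: "'a set" and tiles :: "'a list set set"
  assumes finite_V: "finite V"
    and tile_nonempty: "{} \<notin> tiles"
    and tile_words: "T \<in> tiles \<Longrightarrow> \<exists>n. T \<subseteq> words V n"
    and tile_translate: "T \<in> tiles \<Longrightarrow> u \<in> lists V \<Longrightarrow> v \<in> lists V \<Longrightarrow> (\<lambda>w. u @ w @ v) ` T \<in> tiles"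
begin

abbreviation "W \<equiv> words V"

definition tileable :: "'a list set \<Rightarrow> bool" where
  "tileable D \<longleftrightarrow> (\<exists>P. partition_on D P \<and> P \<subseteq> tiles)"

lemma tileable_empty [simp]: "tileable {}"
  unfolding tileable_def by (auto simp: partition_on_def)

lemma tileable_tile: "T \<in> tiles \<Longrightarrow> tileable T"
  unfolding tileable_def using tile_nonempty partition_on_space[of T] by (intro exI[of _ "{T}"]) auto

lemma tileable_UN:
  assumes "\<And>i. i \<in> I \<Longrightarrow> tileable (D i)" and "disjoint_family_on D I"
  shows "tileable (\<Union>i\<in>I. D i)"
proof -
  obtain P where P: "\<And>i. i \<in> I \<Longrightarrow> partition_on (D i) (P i) \<and> P i \<subseteq> tiles"
    using assms(1) unfolding tileable_def by metis
  have "partition_on (\<Union>i\<in>I. D i) (\<Union>i\<in>I. P i)"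
  proof (rule partition_onI)
    show "\<Union> (\<Union> (P ` I)) = \<Union> (D ` I)"
      using P partition_onD1 by fastforce
    show "{} \<notin> \<Union> (P ` I)" using P partition_onD3 by blast
    fix p q assume pq: "p \<in> \<Union> (P ` I)" "q \<in> \<Union> (P ` I)" "p \<noteq> q"
    then obtain i j where ij: "i \<in> I" "j \<in> I" "p \<in> P i" "q \<in> P j" by blast
    show "disjnt p q"
    proof (cases "i = j")
      case True
      then show ?thesis using ij pq P partition_onD2[of "D i" "P i"] by (auto simp: pairwise_def)
    next
      case False
      then have "D i \<inter> D j = {}" using assms(2) ij by (auto simp: disjoint_family_on_def)
      moreover have "p \<subseteq> D i" "q \<subseteq> D j" using ij P partition_onD1 by blast+
      ultimately show ?thesis by (auto simp: disjnt_def)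
    qed
  qed
  then show ?thesis unfolding tileable_def using P by (intro exI[of _ "\<Union>(P ` I)"]) auto
qed

lemma tileable_Un:
  assumes "tileable A" "tileable B" "A \<inter> B = {}"
  shows "tileable (A \<union> B)"
proof -
  have "tileable (\<Union>b\<in>UNIV. if b then A else B)"
    using assms by (intro tileable_UN) (auto simp: disjoint_family_on_def)
  then show ?thesis by (simp add: UNIV_bool Un_commute)
qed

lemma tileable_translate:
  assumes "tileable D" "u \<in> lists V" "v \<in> lists V"
  shows "tileable ((\<lambda>w. u @ w @ v) ` D)"
proof -
  obtain P where P: "partition_on D P" "P \<subseteq> tiles" using assms(1) unfolding tileable_def by blast
  have "partition_on ((\<lambda>w. u @ w @ v) ` D) ((`) (\<lambda>w. u @ w @ v) ` P - {{}})"
    by (intro partition_on_inj_image P) (auto simp: inj_on_def)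
  then show ?thesis unfolding tileable_def using P(2) assms by (auto intro!: tile_translate)
qed

text \<open>Each suffix from \<open>B\<close> contributes a translate of \<open>A\<close>; the
  common length of the suffixes keeps the translates disjoint.\<close>

lemma tileable_conc_left:
  assumes "tileable A" "B \<subseteq> W n"
  shows "tileable (conc A B)"
proof -
  have "tileable (\<Union>b\<in>B. (\<lambda>w. [] @ w @ b) ` A)"
    using assms by (intro tileable_UN tileable_translate)
      (auto simp: disjoint_family_on_def words_def subset_iff)
  also have "(\<Union>b\<in>B. (\<lambda>w. [] @ w @ b) ` A) = conc A B"
    by (auto simp: conc_def)
  finally show ?thesis .
qed

lemma tileable_conc_right:
  assumes "A \<subseteq> W n" "tileable B"
  shows "tileable (conc A B)"
proof -
  have "tileable (\<Union>a\<in>A. (\<lambda>w. a @ w @ []) ` B)"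
    using assms by (intro tileable_UN tileable_translate)
      (auto simp: disjoint_family_on_def words_def subset_iff)
  also have "(\<Union>a\<in>A. (\<lambda>w. a @ w @ []) ` B) = conc A B"
    by (auto simp: conc_def)
  finally show ?thesis .
qed

section \<open>Systems of removable labels\<close>

text \<open>The \<open>e i\<close> are slots for the tiles counted positively, the
  \<open>f j\<close> for those counted negatively. There is one more slot of the first kind, so both
  kinds grow together from the single \<open>e 0\<close> at \<open>M = 0\<close>.\<close>

definition labels :: "nat \<Rightarrow> 'a list set \<Rightarrow> (nat \<Rightarrow> 'a list set) \<Rightarrow> (nat \<Rightarrow> 'a list set) \<Rightarrow> bool" where
  "labels M X e f \<longleftrightarrow> (\<forall>i\<le>M. e i \<subseteq> X) \<and> (\<forall>j<M. f j \<subseteq> X) \<and>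
     disjoint_family_on e {..M} \<and> disjoint_family_on f {..<M} \<and> (\<forall>i\<le>M. \<forall>j<M. e i \<inter> f j = {}) \<and>
     (\<forall>I J. I \<subseteq> {..M} \<longrightarrow> J \<subseteq> {..<M} \<longrightarrow> card I = Suc (card J) \<longrightarrow>
       tileable (X - (\<Union>(e ` I) \<union> \<Union>(f ` J))))"

lemma
  assumes "labels M X e f"
  shows labels_e: "i \<le> M \<Longrightarrow> e i \<subseteq> X" and labels_f: "j < M \<Longrightarrow> f j \<subseteq> X"
    and labels_ee: "i \<le> M \<Longrightarrow> i' \<le> M \<Longrightarrow> i \<noteq> i' \<Longrightarrow> e i \<inter> e i' = {}"
    and labels_ff: "j < M \<Longrightarrow> j' < M \<Longrightarrow> j \<noteq> j' \<Longrightarrow> f j \<inter> f j' = {}"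
    and labels_ef: "i \<le> M \<Longrightarrow> j < M \<Longrightarrow> e i \<inter> f j = {}"
  using assms unfolding labels_def disjoint_family_on_def by simp_all

lemma labels_tileable:
  assumes "labels M X e f" "I \<subseteq> {..M}" "J \<subseteq> {..<M}" "card I = Suc (card J)"
  shows "tileable (X - (\<Union>(e ` I) \<union> \<Union>(f ` J)))"
proof -
  have "\<forall>I J. I \<subseteq> {..M} \<longrightarrow> J \<subseteq> {..<M} \<longrightarrow> card I = Suc (card J) \<longrightarrow>
       tileable (X - (\<Union>(e ` I) \<union> \<Union>(f ` J)))"
    using assms(1) unfolding labels_def by (elim conjE)
  from this[rule_format, OF assms(2-4)] show ?thesis .
qed

text \<open>In the fibre over \<open>w\<close> the slots in use are those of the tiles containing
  \<open>w\<close>; by \<open>one\<close> there is exactly one more \<open>e\<close> than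
  \<open>f\<close> among them, which is the removal that \<open>labels\<close> permits.\<close>

lemma tileable_conc_labels:
  assumes flex: "labels M X e f" and X: "X \<subseteq> W m"
    and Ps: "length Ps \<le> Suc M" and Ns: "length Ns \<le> M"
    and tile: "\<And>T. T \<in> set Ps \<union> set Ns \<Longrightarrow> T \<in> tiles \<and> T \<subseteq> W n"
    and one: "\<And>w. w \<in> W n \<Longrightarrow>
      length (filter (\<lambda>T. w \<in> T) Ps) = Suc (length (filter (\<lambda>T. w \<in> T) Ns))"
  shows "tileable (conc X (W n))"
proof -
  let ?app = "\<lambda>(x :: 'a list, y). x @ y"
  note e = labels_e[OF flex] and f = labels_f[OF flex]
  define I where "I w = {i. i < length Ps \<and> w \<in> Ps ! i}" for w
  define J where "J w = {j. j < length Ns \<and> w \<in> Ns ! j}" for w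
  have IJ: "I w \<subseteq> {..M}" "J w \<subseteq> {..<M}" for w using Ps Ns by (auto simp: I_def J_def)
  have card: "card (I w) = Suc (card (J w))" if "w \<in> W n" for w
    using one[OF that] by (simp add: length_filter_conv_card I_def J_def)
  define R where "R w = X - (\<Union>(e ` I w) \<union> \<Union>(f ` J w))" for w
  \<comment> \<open>\<open>D1\<close> and \<open>D2\<close> are tiled in the second factor, slot by
    slot; \<open>D3\<close> is the remainder, tiled fibre by fibre in the first factor.\<close>
  define D1 where "D1 = (\<Union>i<length Ps. conc (e i) (Ps ! i))"
  define D2 where "D2 = (\<Union>j<length Ns. conc (f j) (Ns ! j))"
  define D3 where "D3 = (\<Union>w\<in>W n. conc (R w) {w})"
  have inj: "inj_on ?app (W m \<times> UNIV)" by (rule inj_on_append)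
  have D1': "D1 = ?app ` (\<Union>i<length Ps. e i \<times> Ps ! i)"
    and D2': "D2 = ?app ` (\<Union>j<length Ns. f j \<times> Ns ! j)"
    and D3': "D3 = ?app ` (\<Union>w\<in>W n. R w \<times> {w})"
    by (auto simp: D1_def D2_def D3_def conc_def)
  have sub': "e i \<times> Ps ! i \<subseteq> X \<times> W n" if "i < length Ps" for i
    using e[of i] tile[of "Ps ! i"] Ps that by auto
  have sub2': "f j \<times> Ns ! j \<subseteq> X \<times> W n" if "j < length Ns" for j
    using f[of j] tile[of "Ns ! j"] Ns that by auto
  have X': "X \<times> W n \<subseteq> W m \<times> UNIV" using X by auto
  note sub = subset_trans[OF sub' X'] and sub2 = subset_trans[OF sub2' X']
  have sub3: "R w \<times> {w} \<subseteq> W m \<times> UNIV" for w using X by (auto simp: R_def)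
  have disj: "?app ` A \<inter> ?app ` B = {}"
    if "A \<inter> B = {}" "A \<subseteq> W m \<times> UNIV" "B \<subseteq> W m \<times> UNIV" for A B
    using inj_on_image_Int[OF inj that(2,3)] that(1) by simp
  have t1: "tileable D1" unfolding D1_def
  proof (rule tileable_UN)
    show "tileable (conc (e i) (Ps ! i))" if "i \<in> {..<length Ps}" for i
      using that e[of i] X Ps tile[of "Ps ! i"] by (intro tileable_conc_right[of _ m] tileable_tile) auto
    show "disjoint_family_on (\<lambda>i. conc (e i) (Ps ! i)) {..<length Ps}"
      unfolding disjoint_family_on_def conc_def
    proof (intro ballI impI disj sub)
      fix i j assume "i \<in> {..<length Ps}" "j \<in> {..<length Ps}" "i \<noteq> j"
      then have "e i \<inter> e j = {}" using labels_ee[OF flex] Ps by simp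
      then show "e i \<times> Ps ! i \<inter> e j \<times> Ps ! j = {}" by auto
    qed auto
  qed
  have t2: "tileable D2" unfolding D2_def
  proof (rule tileable_UN)
    show "tileable (conc (f i) (Ns ! i))" if "i \<in> {..<length Ns}" for i
      using that f[of i] X Ns tile[of "Ns ! i"] by (intro tileable_conc_right[of _ m] tileable_tile) auto
    show "disjoint_family_on (\<lambda>i. conc (f i) (Ns ! i)) {..<length Ns}"
      unfolding disjoint_family_on_def conc_def
    proof (intro ballI impI disj sub2)
      fix i j assume "i \<in> {..<length Ns}" "j \<in> {..<length Ns}" "i \<noteq> j"
      then have "f i \<inter> f j = {}" using labels_ff[OF flex] Ns by simp
      then show "f i \<times> Ns ! i \<inter> f j \<times> Ns ! j = {}" by auto
    qed auto
  qed
  have t3: "tileable D3" unfolding D3_def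
  proof (rule tileable_UN)
    show "tileable (conc (R w) {w})" if "w \<in> W n" for w
      unfolding R_def using that by (intro tileable_conc_left[of _ _ n] labels_tileable[OF flex] IJ card) auto
    show "disjoint_family_on (\<lambda>w. conc (R w) {w}) (W n)"
      unfolding disjoint_family_on_def conc_def by (intro ballI impI disj sub3) auto
  qed
  have "D1 \<inter> D2 = {}" unfolding D1' D2'
  proof (rule disj)
    show "(\<Union>i<length Ps. e i \<times> Ps ! i) \<inter> (\<Union>j<length Ns. f j \<times> Ns ! j) = {}"
    proof -
      have "e i \<inter> f j = {}" if "i < length Ps" "j < length Ns" for i j
        using labels_ef[OF flex, of i j] that Ps Ns by simp
      then show ?thesis by blast
    qed
  qed (intro UN_least; use sub sub2 in simp)+
  moreover have "(D1 \<union> D2) \<inter> D3 = {}" unfolding D1' D2' D3' image_Un[symmetric]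
  proof (rule disj)
    show "((\<Union>i<length Ps. e i \<times> Ps ! i) \<union> (\<Union>j<length Ns. f j \<times> Ns ! j)) \<inter> (\<Union>w\<in>W n. R w \<times> {w}) = {}"
      by (auto simp: R_def I_def J_def)
  qed (intro Un_least UN_least; use sub sub2 sub3 in simp)+
  ultimately have "tileable (D1 \<union> D2 \<union> D3)" using t1 t2 t3 by (intro tileable_Un) auto
  also have "D1 \<union> D2 \<union> D3 = conc X (W n)"
    unfolding D1' D2' D3' image_Un[symmetric] conc_def
  proof (rule arg_cong[where f = "image ?app"])
    have "(\<Union>i<length Ps. e i \<times> Ps ! i) \<subseteq> X \<times> W n"
      by (intro UN_least sub') simp
    moreover have "(\<Union>j<length Ns. f j \<times> Ns ! j) \<subseteq> X \<times> W n"
      by (intro UN_least sub2') simp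
    moreover have "(\<Union>w\<in>W n. R w \<times> {w}) \<subseteq> X \<times> W n"
      by (auto simp: R_def)
    moreover have "X \<times> W n \<subseteq> (\<Union>i<length Ps. e i \<times> Ps ! i) \<union> (\<Union>j<length Ns. f j \<times> Ns ! j) \<union> (\<Union>w\<in>W n. R w \<times> {w})"
      by (auto simp: R_def I_def J_def)
    ultimately show "(\<Union>i<length Ps. e i \<times> Ps ! i) \<union> (\<Union>j<length Ns. f j \<times> Ns ! j) \<union> (\<Union>w\<in>W n. R w \<times> {w}) = X \<times> W n"
      by blast
  qed
  finally show ?thesis .
qed

text \<open>The columns \<open>a\<close> are filled by copies of the tiling of \<open>A\<close>,
  crossing the rows \<open>A - G\<close> and \<open>A \<inter> G\<close>, and the columns
  \<open>g\<close> by that of \<open>G\<close>, crossing \<open>A \<inter> G\<close> and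
  \<open>G - A\<close>. What then remains of each row is tiled inside \<open>X\<close> by
  \<open>t\<close>.\<close>

lemma tileable_rows:
  assumes A: "tileable A" "A \<subseteq> W n" and G: "tileable G" "G \<subseteq> W n" and X: "X \<subseteq> W m"
    and sub: "a \<subseteq> X" "g \<subseteq> X" "a \<inter> g = {}" "a \<inter> r1 = {}" "a \<inter> r2 = {}" "g \<inter> r2 = {}" "g \<inter> r3 = {}"
    and t: "tileable (X - (r1 \<union> a))" "tileable (X - (r2 \<union> a \<union> g))" "tileable (X - (r3 \<union> g))"
  shows "tileable (conc (A \<union> G) X - (conc (A - G) r1 \<union> conc (A \<inter> G) r2 \<union> conc (G - A) r3))"
proof -
  let ?app = "\<lambda>(x :: 'a list, y). x @ y"
  let ?R1 = "(A - G) \<times> (X - (r1 \<union> a))" and ?R2 = "A \<times> a" and ?R3 = "(A \<inter> G) \<times> (X - (r2 \<union> a \<union> g))"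
    and ?R4 = "G \<times> g" and ?R5 = "(G - A) \<times> (X - (r3 \<union> g))"
  have inj: "inj_on ?app (W n \<times> UNIV)" by (rule inj_on_append)
  have Un: "tileable (?app ` (R \<union> R'))"
    if "tileable (?app ` R)" "tileable (?app ` R')" "R \<inter> R' = {}" "R \<subseteq> W n \<times> UNIV" "R' \<subseteq> W n \<times> UNIV" for R R'
    unfolding image_Un using that inj_on_image_Int[OF inj that(4,5)] by (intro tileable_Un) simp_all
  have "tileable (?app ` ?R1)" "tileable (?app ` ?R3)" "tileable (?app ` ?R5)"
    using A G t unfolding conc_def[symmetric] by (auto intro!: tileable_conc_right[of _ n])
  moreover have "tileable (?app ` ?R2)" "tileable (?app ` ?R4)"
    using A G X sub unfolding conc_def[symmetric] by (auto intro!: tileable_conc_left[of _ _ m])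
  ultimately have "tileable (?app ` (?R1 \<union> ?R2 \<union> ?R3 \<union> ?R4 \<union> ?R5))"
    using sub A(2) G(2) by (intro Un) auto
  also have "?R1 \<union> ?R2 \<union> ?R3 \<union> ?R4 \<union> ?R5 =
    (A \<union> G) \<times> X - ((A - G) \<times> r1 \<union> (A \<inter> G) \<times> r2 \<union> (G - A) \<times> r3)"
    using sub by auto
  also have "?app ` \<dots> = ?app ` ((A \<union> G) \<times> X) - ?app ` ((A - G) \<times> r1 \<union> (A \<inter> G) \<times> r2 \<union> (G - A) \<times> r3)"
    using A(2) G(2) by (intro inj_on_image_set_diff[OF inj]) auto
  finally show ?thesis by (simp only: conc_def image_Un)
qed

lemma conc_disjoint:
  assumes "A \<subseteq> W n" "A' \<subseteq> W n" "A \<inter> A' = {} \<or> B \<inter> B' = {}"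
  shows "conc A B \<inter> conc A' B' = {}"
proof -
  have "(A \<times> B) \<inter> (A' \<times> B') = {}" using assms(3) by auto
  moreover have "A \<times> B \<subseteq> W n \<times> UNIV" "A' \<times> B' \<subseteq> W n \<times> UNIV" using assms by auto
  ultimately show ?thesis
    using inj_on_image_Int[OF inj_on_append, of "A \<times> B" V n "A' \<times> B'"] by (simp add: conc_def)
qed

text \<open>
  With \<open>K = A - G\<close>, \<open>E = A \<inter> G\<close> and \<open>L = G - A\<close> the product \<open>(A \<union> G) \<times> X\<close> has three rows, where \<open>A\<close> joins
  the first two and \<open>G\<close> the last two. The old labels are kept in row \<open>K\<close>, and \<open>e\<^sub>0\<close> in the rows \<open>L\<close> and
  \<open>E\<close> gives one new label of each kind. If only one of the new labels is removed, the deficit in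
  row \<open>K\<close> is repaired by an old label that has not been removed; it exists by counting.
\<close>

lemma labels_extend:
  assumes A: "tileable A" "A \<subseteq> W n" and G: "tileable G" "G \<subseteq> W n" and X: "X \<subseteq> W m"
    and lab: "labels M X e f"
  shows "labels (Suc M) (conc (A \<union> G) X)
    (\<lambda>i. if i \<le> M then conc (A - G) (e i) else conc (G - A) (e 0))
    (\<lambda>j. if j < M then conc (A - G) (f j) else conc (A \<inter> G) (e 0))" (is "labels _ _ ?e ?f")
  unfolding labels_def
proof (intro conjI allI impI)
  note e = labels_e[OF lab] and f = labels_f[OF lab]
  have W: "A - G \<subseteq> W n" "G - A \<subseteq> W n" "A \<inter> G \<subseteq> W n" using A G by auto
  have same: "conc (A - G) B \<inter> conc (A - G) B' = {}" if "B \<inter> B' = {}" for B B'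
    using W that by (intro conc_disjoint[of _ n]) auto
  have diff: "conc (A - G) B \<inter> conc (G - A) B' = {}" "conc (G - A) B \<inter> conc (A - G) B' = {}"
    "conc (A - G) B \<inter> conc (A \<inter> G) B' = {}" "conc (A \<inter> G) B \<inter> conc (A - G) B' = {}"
    "conc (G - A) B \<inter> conc (A \<inter> G) B' = {}" for B B'
    using W by (intro conc_disjoint[of _ n]; blast)+
  show "?e i \<subseteq> conc (A \<union> G) X" if "i \<le> Suc M" for i
    using e[of i] e[of 0] by (cases "i \<le> M") (simp, intro conc_mono; auto)+
  show "?f j \<subseteq> conc (A \<union> G) X" if "j < Suc M" for j
    using e[of 0] f[of j] by (cases "j < M") (simp, intro conc_mono; auto)+
  show "disjoint_family_on ?e {..Suc M}" unfolding disjoint_family_on_def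
  proof (intro ballI impI)
    fix i j assume "i \<in> {..Suc M}" "j \<in> {..Suc M}" "i \<noteq> j"
    then show "?e i \<inter> ?e j = {}"
      using labels_ee[OF lab, of i j] by (cases "i \<le> M"; cases "j \<le> M") (simp_all add: same diff le_Suc_eq)
  qed
  show "disjoint_family_on ?f {..<Suc M}" unfolding disjoint_family_on_def
  proof (intro ballI impI)
    fix i j assume "i \<in> {..<Suc M}" "j \<in> {..<Suc M}" "i \<noteq> j"
    then show "?f i \<inter> ?f j = {}"
      using labels_ff[OF lab, of i j] by (cases "i < M"; cases "j < M") (simp_all add: same diff less_Suc_eq)
  qed
  show "?e i \<inter> ?f j = {}" if "i \<le> Suc M" "j < Suc M" for i j
    using labels_ef[OF lab, of i j] that by (simp add: same diff)
  fix I J assume I: "I \<subseteq> {..Suc M}" and J: "J \<subseteq> {..<Suc M}" and card: "card I = Suc (card J)"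
  define I' J' where "I' = I - {Suc M}" and "J' = J - {M}"
  have I': "I' \<subseteq> {..M}" and J': "J' \<subseteq> {..<M}" using I J by (auto simp: I'_def J'_def less_Suc_eq atMost_Suc)
  have fin: "finite I'" "finite J'" using I' J' finite_subset by blast+
  have "finite I" "finite J" using I J finite_subset by blast+
  then have cI: "card I = (if Suc M \<in> I then Suc (card I') else card I')"
    and cJ: "card J = (if M \<in> J then Suc (card J') else card J')"
    unfolding I'_def J'_def by (simp_all add: card_Suc_Diff1 del: card_Diff_insert)
  define R where "R = \<Union>(e ` I') \<union> \<Union>(f ` J')"
  define r2 where "r2 = (if M \<in> J then e 0 else {})"
  define r3 where "r3 = (if Suc M \<in> I then e 0 else {})"
  note row = tileable_rows[OF A G X, of _ _ R r2 r3]
  have e0: "e 0 \<subseteq> X" by (simp add: e)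
  have single: "tileable (X - e i)" if "i \<le> M" for i
    using labels_tileable[OF lab, of "{i}" "{}"] that by simp
  have "tileable (conc (A \<union> G) X - (conc (A - G) R \<union> conc (A \<inter> G) r2 \<union> conc (G - A) r3))"
  proof (cases "Suc M \<in> I"; cases "M \<in> J")
    \<comment> \<open>With no new label removed, \<open>G\<close> over all of \<open>X\<close> fills
      the rows \<open>A \<inter> G\<close> and \<open>G - A\<close> completely.\<close>
    assume *: "Suc M \<notin> I" "M \<notin> J"
    then have "card I' = Suc (card J')" using card cI cJ by simp
    from labels_tileable[OF lab I' J' this] show ?thesis
      using * by (intro row[of "{}" X]) (auto simp: R_def r2_def r3_def)
  next
    \<comment> \<open>Both rows met by \<open>G\<close> lack the same \<open>e 0\<close>, so
      \<open>G\<close> over \<open>X - e 0\<close> fills what remains of them.\<close>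
    assume *: "Suc M \<in> I" "M \<in> J"
    then have "card I' = Suc (card J')" using card cI cJ by simp
    from labels_tileable[OF lab I' J' this] show ?thesis
      using * e0 by (intro row[of "{}" "X - e 0"]) (auto simp: R_def r2_def r3_def Un_absorb1)
  next
    \<comment> \<open>\<open>A\<close> over an unremoved \<open>e i\<close> restores the surplus of
      one in row \<open>A - G\<close>; row \<open>A \<inter> G\<close> then lacks only
      \<open>e i\<close>, and row \<open>G - A\<close> only \<open>e 0\<close>.\<close>
    assume *: "Suc M \<in> I" "M \<notin> J"
    then have c: "card I' = card J'" using card cI cJ by simp
    also have "card J' \<le> M" using card_mono[OF _ J'] by simp
    finally have "I' \<noteq> {..M}" by auto
    then obtain i where i: "i \<le> M" "i \<notin> I'" using I' by auto
    have "tileable (X - (\<Union>(e ` insert i I') \<union> \<Union>(f ` J')))"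
      using I' i fin c by (intro labels_tileable[OF lab] J') auto
    moreover have "e i \<inter> R = {}"
      unfolding R_def using labels_ee[OF lab, of i] labels_ef[OF lab, of i] I' J' i by blast
    ultimately show ?thesis
      using * i e[of i] single[of i] single[of 0]
      by (intro row[of "e i" "{}"]) (auto simp: R_def r2_def r3_def Un_ac)
  next
    \<comment> \<open>In row \<open>A - G\<close> the surplus is two, and \<open>A\<close> over an
      unremoved \<open>f j\<close> brings it to one. Row \<open>A \<inter> G\<close> then lacks
      \<open>e 0\<close> and \<open>f j\<close>, so \<open>G\<close> over \<open>e 1\<close>
      restores a surplus of one there and leaves \<open>X - e 1\<close> in row
      \<open>G - A\<close>.\<close>
    assume *: "Suc M \<notin> I" "M \<in> J"
    then have c: "card I' = Suc (Suc (card J'))" using card cI cJ by simp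
    moreover have "card I' \<le> Suc M" using card_mono[OF _ I'] by simp
    ultimately have "J' \<noteq> {..<M}" by auto
    then obtain j where j: "j < M" "j \<notin> J'" using J' by auto
    have "R \<union> f j = \<Union>(e ` I') \<union> \<Union>(f ` insert j J')"
      by (auto simp: R_def)
    moreover have "tileable (X - (\<Union>(e ` I') \<union> \<Union>(f ` insert j J')))"
      using J' j fin c by (intro labels_tileable[OF lab] I') auto
    ultimately have "tileable (X - (R \<union> f j))" by simp
    moreover have "f j \<inter> R = {}"
      unfolding R_def using labels_ff[OF lab, of j] labels_ef[OF lab, of _ j] I' J' j by blast
    moreover have "tileable (X - (\<Union>(e ` {0, 1}) \<union> \<Union>(f ` {j})))"
      using j by (intro labels_tileable[OF lab]) auto
    then have "tileable (X - (e 0 \<union> f j \<union> e 1))"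
      by (simp add: Un_ac)
    moreover have "e 1 \<inter> e 0 = {}" "f j \<inter> e 0 = {}" "f j \<inter> e 1 = {}"
      using j labels_ee[OF lab, of 1 0] labels_ef[OF lab, of 0 j] labels_ef[OF lab, of 1 j]
      by (simp_all add: Int_commute)
    moreover have "r2 = e 0" "r3 = {}" using * by (simp_all add: r2_def r3_def)
    ultimately show ?thesis
      using j e[of 1] f[of j] single[of 1] by (intro row[of "f j" "e 1"]) simp_all
  qed
  moreover have "\<Union>(?e ` I) = conc (A - G) (\<Union>(e ` I')) \<union> conc (G - A) r3"
  proof -
    have "\<Union>(?e ` I') = (\<Union>i\<in>I'. conc (A - G) (e i))" using I' by (intro SUP_cong) auto
    moreover have "\<Union>(?e ` I) = \<Union>(?e ` I') \<union> (if Suc M \<in> I then ?e (Suc M) else {})"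
    proof (cases "Suc M \<in> I")
      case True
      then have "I = insert (Suc M) I'" by (auto simp: I'_def)
      then have "\<Union>(?e ` I) = ?e (Suc M) \<union> \<Union>(?e ` I')" by (simp only: image_insert Union_insert)
      then show ?thesis using True by (simp only: if_True Un_commute)
    qed (simp add: I'_def)
    ultimately show ?thesis by (simp add: r3_def conc_UN_right)
  qed
  moreover have "\<Union>(?f ` J) = conc (A - G) (\<Union>(f ` J')) \<union> conc (A \<inter> G) r2"
  proof -
    have "\<Union>(?f ` J') = (\<Union>j\<in>J'. conc (A - G) (f j))" using J' by (intro SUP_cong) auto
    moreover have "\<Union>(?f ` J) = \<Union>(?f ` J') \<union> (if M \<in> J then ?f (M) else {})"
    proof (cases "M \<in> J")
      case True
      then have "J = insert (M) J'" by (auto simp: J'_def)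
      then have "\<Union>(?f ` J) = ?f (M) \<union> \<Union>(?f ` J')" by (simp only: image_insert Union_insert)
      then show ?thesis using True by (simp only: if_True Un_commute)
    qed (simp add: J'_def)
    ultimately show ?thesis by (simp add: r2_def conc_UN_right)
  qed
  moreover have "conc (A - G) R = conc (A - G) (\<Union>(e ` I')) \<union> conc (A - G) (\<Union>(f ` J'))"
    by (simp add: R_def conc_Un_right)
  ultimately show "tileable (conc (A \<union> G) X - (\<Union>(?e ` I) \<union> \<Union>(?f ` J)))"
    by (simp add: Un_ac)
qed

text \<open>At \<open>M = 0\<close> the only admissible removal takes away \<open>A - G\<close> and
  leaves \<open>G\<close>.\<close>

lemma labels_base:
  assumes "tileable G"
  shows "labels 0 (A \<union> G) (\<lambda>i. A - G) (\<lambda>j. {})"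
proof -
  have "tileable (A \<union> G - (A - G))"
  proof -
    have "A \<union> G - (A - G) = G" by blast
    then show ?thesis using assms by simp
  qed
  moreover have "I = {0}" if "I \<subseteq> {..0}" "card I = Suc 0" for I :: "nat set"
    using that by (auto simp: card_1_singleton_iff)
  ultimately show ?thesis
    unfolding labels_def by (auto simp: disjoint_family_on_def)
qed

section \<open>Products of factors \<open>D\<close> and \<open>W q\<close>, and the absorption of
  tiles\<close>

text \<open>\<open>True\<close> stands for a factor \<open>D\<close> and \<open>False\<close> for a factor \<open>W q\<close>.\<close>

primrec lang :: "nat \<Rightarrow> bool list \<Rightarrow> 'a list set \<Rightarrow> 'a list set" where
  "lang q [] D = {[]}"
| "lang q (b # p) D = conc (if b then D else W q) (lang q p D)"

lemma lang_append: "lang q (p @ p') D = conc (lang q p D) (lang q p' D)"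
  by (induction p) (simp_all add: conc_assoc)

lemma lang_mono: "D \<subseteq> D' \<Longrightarrow> lang q p D \<subseteq> lang q p D'"
  by (induction p) (simp_all add: conc_mono)

lemma lang_words: "D \<subseteq> W q \<Longrightarrow> lang q p D \<subseteq> W (q * length p)"
proof (induction p)
  case (Cons b p)
  then have "conc (if b then D else W q) (lang q p D) \<subseteq> W (q + q * length p)"
    by (intro conc_subset_words) auto
  then show ?case by simp
qed simp

lemma lang_full: "lang q p (W q) = W (q * length p)"
  by (induction p) (simp_all add: conc_words)

text \<open>A word of the difference has a \<open>D\<close>-factor in \<open>T\<close>; sorting by
  the first one splits off pieces that are tileable through this factor. In \<open>step\<close>,
  \<open>S\<close> is \<open>T\<close> at a factor \<open>D\<close> and empty at a factor
  \<open>W q\<close>.\<close>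

lemma tileable_lang_diff:
  assumes "tileable T" "T \<subseteq> D" "D \<subseteq> W q"
  shows "tileable (lang q p D - lang q p (D - T))"
proof (induction p)
  case (Cons b p)
  let ?L = "lang q p D" and ?L' = "lang q p (D - T)"
  have L: "?L \<subseteq> W (q * length p)" "?L' \<subseteq> ?L" using assms(3) by (intro lang_words lang_mono; blast)+
  have step: "tileable (conc B ?L - conc (B - S) ?L')"
    if "tileable S" "S \<subseteq> B" "B \<subseteq> W q" for B S
  proof -
    have inj: "inj_on (\<lambda>(x, y). x @ y) (W q \<times> UNIV)" by (rule inj_on_append)
    have "conc B ?L - conc (B - S) ?L' = (\<lambda>(x, y). x @ y) ` (B \<times> ?L - (B - S) \<times> ?L')"
      unfolding conc_def using that L by (intro inj_on_image_set_diff[OF inj, symmetric]) auto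
    also have "B \<times> ?L - (B - S) \<times> ?L' = S \<times> ?L \<union> (B - S) \<times> (?L - ?L')"
      using that L by auto
    finally have "conc B ?L - conc (B - S) ?L' = conc S ?L \<union> conc (B - S) (?L - ?L')"
      by (simp only: image_Un conc_def)
    moreover have "tileable (conc S ?L \<union> conc (B - S) (?L - ?L'))"
    proof (intro tileable_Un tileable_conc_left[OF _ L(1)] tileable_conc_right[OF _ Cons.IH, of _ q] conc_disjoint[of _ q])
    qed (use that in auto)
    ultimately show ?thesis by simp
  qed
  show ?case using step[of T D] step[of "{}" "W q"] assms by simp
qed simp

theorem tileable_words:
  assumes tile: "\<And>T. T \<in> set Ps \<union> set Ns \<Longrightarrow> T \<in> tiles \<and> T \<subseteq> W q"
    and one: "\<And>w. w \<in> W q \<Longrightarrow>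
      length (filter (\<lambda>T. w \<in> T) Ps) = Suc (length (filter (\<lambda>T. w \<in> T) Ns))"
  shows "\<exists>N. \<forall>n\<ge>N. tileable (W n)"
proof -
  define M where "M = length Ps + length Ns"
  \<comment> \<open>Absorbs one tile: \<open>M + 1\<close> repetitions of \<open>p\<close> provide
    the labels, and a final factor \<open>W q\<close> carries the integer combination.\<close>
  have fill: "\<exists>p. tileable (lang q p (D \<union> T))"
    if D: "D \<subseteq> W q" and p: "tileable (lang q p D)" and T: "T \<in> tiles" "T \<subseteq> W q" for D p T
  proof -
    define G where "G = lang q p D"
    \<comment> \<open>\<open>A\<close> collects the words with some factor in \<open>T\<close>; all
      other words of the product lie in \<open>G\<close>, since \<open>D \<union> T - T\<close> is
      contained in \<open>D\<close>.\<close>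
    define A where "A = lang q p (D \<union> T) - lang q p (D \<union> T - T)"
    have A: "tileable A" unfolding A_def using D T by (intro tileable_lang_diff tileable_tile) auto
    have AG: "A \<union> G = lang q p (D \<union> T)"
    proof -
      have "lang q p (D \<union> T - T) \<subseteq> G" "G \<subseteq> lang q p (D \<union> T)"
        unfolding G_def by (intro lang_mono; blast)+
      then show ?thesis unfolding A_def by blast
    qed
    have AGw: "A \<union> G \<subseteq> W (q * length p)" unfolding AG using D T by (intro lang_words) auto
    have "\<exists>e f. labels k (lang q (concat (replicate (Suc k) p)) (D \<union> T)) e f" for k
    proof (induction k)
      case 0
      show ?case using labels_base[of G A] p by (auto simp: AG G_def[symmetric])
    next
      case (Suc k)
      then obtain e f where ef: "labels k (lang q (concat (replicate (Suc k) p)) (D \<union> T)) e f" by blast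
      have "lang q (concat (replicate (Suc (Suc k)) p)) (D \<union> T) =
          conc (A \<union> G) (lang q (concat (replicate (Suc k) p)) (D \<union> T))"
        unfolding AG lang_append[symmetric] by simp
      moreover have "lang q (concat (replicate (Suc k) p)) (D \<union> T) \<subseteq> W (q * length (concat (replicate (Suc k) p)))"
        using D T by (intro lang_words) auto
      moreover have "A \<subseteq> W (q * length p)" "G \<subseteq> W (q * length p)" using AGw by auto
      ultimately show ?case using labels_extend[OF A _ p[folded G_def] _ _ ef] by metis
    qed
    then obtain e f where ef: "labels M (lang q (concat (replicate (Suc M) p)) (D \<union> T)) e f" by blast
    have "D \<union> T \<subseteq> W q" using D T by auto
    from tileable_conc_labels[OF ef lang_words[OF this], of Ps Ns] tile one
    have "tileable (conc (lang q (concat (replicate (Suc M) p)) (D \<union> T)) (W q))"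
      by (simp add: M_def)
    also have "conc (lang q (concat (replicate (Suc M) p)) (D \<union> T)) (W q) =
        lang q (concat (replicate (Suc M) p) @ [False]) (D \<union> T)"
      by (simp add: lang_append conc_assoc)
    finally show ?thesis by blast
  qed
  have "\<exists>p. tileable (lang q p (\<Union>(set Ts)))" if "set Ts \<subseteq> set Ps" for Ts
    using that
  proof (induction Ts)
    case Nil
    \<comment> \<open>The pattern must have a factor, since the empty product is \<open>{[]}\<close>
      rather than the empty set.\<close>
    have "tileable (lang q [True] {})" by (simp add: conc_def)
    then show ?case by (intro exI[of _ "[True]"]) simp
  next
    case (Cons T Ts)
    then obtain p where "tileable (lang q p (\<Union>(set Ts)))" by auto
    moreover have "\<Union>(set Ts) \<subseteq> W q" "T \<in> tiles" "T \<subseteq> W q" using Cons.prems tile by auto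
    ultimately show ?case using fill[of "\<Union>(set Ts)" p T] by (simp add: Un_commute)
  qed
  then obtain p where "tileable (lang q p (\<Union>(set Ps)))" by blast
  moreover have "\<Union>(set Ps) = W q"
  proof
    show "W q \<subseteq> \<Union>(set Ps)"
    proof
      fix w assume "w \<in> W q"
      then have "filter (\<lambda>T. w \<in> T) Ps \<noteq> []" using one by (metis length_0_conv nat.distinct(1))
      then show "w \<in> \<Union>(set Ps)" by (auto simp: filter_empty_conv)
    qed
  qed (use tile in auto)
  ultimately have *: "tileable (W (q * length p))" by (simp add: lang_full)
  have "tileable (W n)" if "n \<ge> q * length p" for n
    using tileable_conc_left[OF * subset_refl, of "n - q * length p"] that by (simp add: conc_words)
  then show ?thesis by blast
qed

section \<open>Integer combinations of tiles\<close>

definition cover_count :: "'a list set list \<Rightarrow> 'a list \<Rightarrow> int" where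
  "cover_count Ts w = int (length (filter (\<lambda>T. w \<in> T) Ts))"

text \<open>The group generated by the indicators of tiles in dimension \<open>n\<close>, compared
  only on \<open>W n\<close>. Two lists with repetition record positive and negative contributions,
  in the form taken by \<open>tileable_words\<close>.\<close>

definition tile_span :: "nat \<Rightarrow> ('a list \<Rightarrow> int) \<Rightarrow> bool" where
  "tile_span n \<phi> \<longleftrightarrow> (\<exists>Ps Ns. set Ps \<union> set Ns \<subseteq> {T \<in> tiles. T \<subseteq> W n} \<and>
     (\<forall>w\<in>W n. \<phi> w = cover_count Ps w - cover_count Ns w))"

lemma tile_spanI:
  assumes "set Ps \<union> set Ns \<subseteq> {T \<in> tiles. T \<subseteq> W n}" "\<And>w. w \<in> W n \<Longrightarrow> \<phi> w = cover_count Ps w - cover_count Ns w"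
  shows "tile_span n \<phi>"
  unfolding tile_span_def by (intro exI[of _ Ps] exI[of _ Ns] conjI ballI assms)

lemma tile_spanE:
  assumes "tile_span n \<phi>"
  obtains Ps Ns where "set Ps \<union> set Ns \<subseteq> {T \<in> tiles. T \<subseteq> W n}" "\<And>w. w \<in> W n \<Longrightarrow> \<phi> w = cover_count Ps w - cover_count Ns w"
proof -
  from assms[unfolded tile_span_def] obtain Ps Ns where "set Ps \<union> set Ns \<subseteq> {T \<in> tiles. T \<subseteq> W n}"
    and "\<forall>w\<in>W n. \<phi> w = cover_count Ps w - cover_count Ns w" by (elim exE conjE)
  then show thesis by (intro that) auto
qed

lemma cover_count_append: "cover_count (Ps @ Qs) w = cover_count Ps w + cover_count Qs w"
  by (simp add: cover_count_def)

lemma tile_span_cong: "tile_span n \<phi> \<Longrightarrow> (\<And>w. w \<in> W n \<Longrightarrow> \<phi> w = \<psi> w) \<Longrightarrow> tile_span n \<psi>"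
  by (erule tile_spanE, erule tile_spanI) simp

lemma tile_span_0: "tile_span n (\<lambda>w. 0)"
  by (rule tile_spanI[of "[]" "[]"]) auto

lemma tile_span_tile: "T \<in> tiles \<Longrightarrow> T \<subseteq> W n \<Longrightarrow> tile_span n (\<lambda>w. of_bool (w \<in> T))"
  by (rule tile_spanI[of "[T]" "[]"]) (auto simp: cover_count_def)

lemma tile_span_diff:
  assumes "tile_span n \<phi>" "tile_span n \<psi>"
  shows "tile_span n (\<lambda>w. \<phi> w - \<psi> w)"
proof -
  obtain Ps Ns where 1: "set Ps \<union> set Ns \<subseteq> {T \<in> tiles. T \<subseteq> W n}" "\<And>w. w \<in> W n \<Longrightarrow> \<phi> w = cover_count Ps w - cover_count Ns w"
    using assms(1) by (rule tile_spanE) blast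
  obtain Qs Rs where 2: "set Qs \<union> set Rs \<subseteq> {T \<in> tiles. T \<subseteq> W n}" "\<And>w. w \<in> W n \<Longrightarrow> \<psi> w = cover_count Qs w - cover_count Rs w"
    using assms(2) by (rule tile_spanE) blast
  show ?thesis
    using 1 2 by (intro tile_spanI[of "Ps @ Rs" "Ns @ Qs"]) (auto simp: cover_count_append)
qed

lemma tile_span_add:
  assumes "tile_span n \<phi>" "tile_span n \<psi>"
  shows "tile_span n (\<lambda>w. \<phi> w + \<psi> w)"
  using tile_span_diff[OF assms(1) tile_span_diff[OF tile_span_0 assms(2)]] by simp

lemma tile_span_sum:
  "(\<And>i. i \<in> I \<Longrightarrow> tile_span n (\<phi> i)) \<Longrightarrow> tile_span n (\<lambda>w. \<Sum>i\<in>I. \<phi> i w)"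
  by (induction I rule: infinite_finite_induct) (auto intro: tile_span_0 tile_span_add)

lemma tile_span_scale:
  assumes "tile_span n \<phi>"
  shows "tile_span n (\<lambda>w. c * \<phi> w)"
proof -
  have nat: "tile_span n (\<lambda>w. int m * \<phi> w)" for m
    using tile_span_sum[of "{..<m}" n "\<lambda>_. \<phi>"] assms by simp
  show ?thesis
  proof (cases "c \<ge> 0")
    case True
    then show ?thesis using nat[of "nat c"] by simp
  next
    case False
    then show ?thesis using tile_span_diff[OF tile_span_0 nat[of "nat (- c)"]] by simp
  qed
qed

text \<open>Padding every tile with \<open>u\<close> and \<open>v\<close> moves the combination to
  the slice of words with this prefix and suffix; it vanishes off the slice.\<close>

lemma tile_span_translate:
  assumes "tile_span n \<phi>" "u \<in> W l" "v \<in> W m"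
  shows "tile_span (l + n + m) (\<lambda>w. of_bool (take l w = u \<and> drop (l + n) w = v) * \<phi> (take n (drop l w)))"
proof -
  obtain Ps Ns where 1: "set Ps \<union> set Ns \<subseteq> {T \<in> tiles. T \<subseteq> W n}" "\<And>w. w \<in> W n \<Longrightarrow> \<phi> w = cover_count Ps w - cover_count Ns w"
    using assms(1) by (rule tile_spanE) blast
  define tr where "tr = (\<lambda>w. u @ w @ v)"
  have tr: "(w \<in> tr ` T) \<longleftrightarrow> take l w = u \<and> drop (l + n) w = v \<and> take n (drop l w) \<in> T"
    if "w \<in> W (l + n + m)" "T \<subseteq> W n" for w T
  proof
    assume "w \<in> tr ` T"
    then obtain x where "x \<in> T" "w = u @ x @ v" by (auto simp: tr_def)
    then show "take l w = u \<and> drop (l + n) w = v \<and> take n (drop l w) \<in> T"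
      using that(2) assms(2,3) by (auto simp: words_def)
  next
    assume *: "take l w = u \<and> drop (l + n) w = v \<and> take n (drop l w) \<in> T"
    have "w = take l w @ take n (drop l w) @ drop n (drop l w)"
      by (simp only: append_take_drop_id)
    then have "w = tr (take n (drop l w))" using * unfolding tr_def by (simp add: add.commute)
    then show "w \<in> tr ` T" using * by blast
  qed
  have m: "cover_count (map ((`) tr) Ts) w = of_bool (take l w = u \<and> drop (l + n) w = v) * cover_count Ts (take n (drop l w))"
    if "w \<in> W (l + n + m)" "set Ts \<subseteq> {T \<in> tiles. T \<subseteq> W n}" for w Ts
    using that(2) by (induction Ts) (use that(1) tr in \<open>auto simp: cover_count_def\<close>)
  have mid: "take n (drop l w) \<in> W n" if "w \<in> W (l + n + m)" for w
    using that by (auto simp: words_def dest!: in_set_takeD in_set_dropD)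
  have tr_tile: "tr ` T \<in> {T \<in> tiles. T \<subseteq> W (l + n + m)}" if "T \<in> {T \<in> tiles. T \<subseteq> W n}" for T
  proof -
    have "tr ` T \<in> tiles"
      unfolding tr_def using that assms(2,3) by (intro tile_translate words_in_lists) auto
    moreover have "tr x \<in> W (l + n + m)" if "x \<in> W n" for x
      using that assms(2,3) by (simp add: tr_def words_def)
    ultimately show ?thesis using that by blast
  qed
  show ?thesis
  proof (rule tile_spanI)
    show "set (map ((`) tr) Ps) \<union> set (map ((`) tr) Ns) \<subseteq> {T \<in> tiles. T \<subseteq> W (l + n + m)}"
      using 1(1) tr_tile by (simp only: set_map image_subset_iff Un_subset_iff) blast
    fix w assume "w \<in> W (l + n + m)"
    then show "of_bool (take l w = u \<and> drop (l + n) w = v) * \<phi> (take n (drop l w)) =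
        cover_count (map ((`) tr) Ps) w - cover_count (map ((`) tr) Ns) w"
      using 1 mid by (simp add: m right_diff_distrib)
  qed
qed

text \<open>On a word with halves \<open>x\<close> and \<open>y\<close>, write
  \<open>1 = (1 - h * g x) + h * g x\<close>. The first term is a combination in \<open>x\<close>
  for each fixed \<open>y\<close>; the second is, for each fixed \<open>x\<close>, the multiple by
  \<open>g x\<close> of a combination in \<open>y\<close>.\<close>

lemma tile_span_one:
  assumes "tile_span k (\<lambda>w. 1 - h * g w)" "tile_span k (\<lambda>w. h)"
  shows "tile_span (k + k) (\<lambda>w. 1)"
proof -
  have take: "take k w \<in> W k" and drop: "drop k w \<in> W k" if "w \<in> W (k + k)" for w
    using that by (auto simp: words_def dest!: in_set_takeD in_set_dropD)
  have fin: "finite (W k)" by (rule finite_words[OF finite_V])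
  have "tile_span (k + k) (\<lambda>w. \<Sum>v\<in>W k. of_bool (drop k w = v) * (1 - h * g (take k w)))"
    using tile_span_translate[OF assms(1), of "[]" 0 _ k] by (intro tile_span_sum) simp
  then have 1: "tile_span (k + k) (\<lambda>w. 1 - h * g (take k w))"
  proof (rule tile_span_cong)
    fix w assume "w \<in> W (k + k)"
    from drop[OF this] show "(\<Sum>v\<in>W k. of_bool (drop k w = v) * (1 - h * g (take k w))) = 1 - h * g (take k w)"
      using fin by (simp add: sum_distrib_right[symmetric] of_bool_def)
  qed
  have "tile_span (k + k) (\<lambda>w. \<Sum>u\<in>W k. g u * (of_bool (take k w = u) * h))"
  proof (intro tile_span_sum tile_span_scale)
    fix u assume "u \<in> W k"
    from tile_span_translate[OF assms(2) this, of "[]" 0]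
    have "tile_span (k + k) (\<lambda>w. of_bool (take k w = u \<and> drop (k + k) w = []) * h)" by simp
    then show "tile_span (k + k) (\<lambda>w. of_bool (take k w = u) * h)"
      by (rule tile_span_cong) (simp add: words_def)
  qed
  then have 2: "tile_span (k + k) (\<lambda>w. h * g (take k w))"
  proof (rule tile_span_cong)
    fix w assume "w \<in> W (k + k)"
    from take[OF this] show "(\<Sum>u\<in>W k. g u * (of_bool (take k w = u) * h)) = h * g (take k w)"
      using fin by (simp add: of_bool_def if_distrib[of "\<lambda>x. _ * x"] if_distrib[of "\<lambda>x. x * _"] cong: if_cong)
  qed
  show ?thesis using tile_span_add[OF 1 2] by simp
qed

lemma tileable_words_of_tile_span:
  assumes "tile_span q (\<lambda>w. 1)"
  shows "\<exists>N. \<forall>n\<ge>N. tileable (W n)"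
proof -
  obtain Ps Ns where *: "set Ps \<union> set Ns \<subseteq> {T \<in> tiles. T \<subseteq> W q}" "\<And>w. w \<in> W q \<Longrightarrow> 1 = cover_count Ps w - cover_count Ns w"
    using assms by (rule tile_spanE) blast
  show ?thesis
  proof (rule tileable_words[of Ps Ns q])
    show "length (filter (\<lambda>T. w \<in> T) Ps) = Suc (length (filter (\<lambda>T. w \<in> T) Ns))" if "w \<in> W q" for w
      using *(2)[OF that] by (simp add: cover_count_def)
  qed (use *(1) in auto)
qed

section \<open>Combinations of tiles modulo \<open>h\<close>\<close>

definition tile_span_mod :: "int \<Rightarrow> nat \<Rightarrow> ('a list \<Rightarrow> int) \<Rightarrow> bool" where
  "tile_span_mod h n \<phi> \<longleftrightarrow> (\<exists>g. tile_span n (\<lambda>w. \<phi> w - h * g w))"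

lemma tile_span_mod_cong:
  assumes "tile_span_mod h n \<phi>" "\<And>w. w \<in> W n \<Longrightarrow> \<phi> w = \<psi> w"
  shows "tile_span_mod h n \<psi>"
proof -
  obtain g where "tile_span n (\<lambda>w. \<phi> w - h * g w)"
    using assms(1) unfolding tile_span_mod_def by (elim exE)
  then have "tile_span n (\<lambda>w. \<psi> w - h * g w)"
    by (rule tile_span_cong) (simp add: assms(2))
  then show ?thesis unfolding tile_span_mod_def by (rule exI[of _ g])
qed

lemma tile_span_mod_diff:
  assumes "tile_span_mod h n \<phi>" "tile_span_mod h n \<psi>"
  shows "tile_span_mod h n (\<lambda>w. \<phi> w - \<psi> w)"
proof -
  obtain g g' where "tile_span n (\<lambda>w. \<phi> w - h * g w)" "tile_span n (\<lambda>w. \<psi> w - h * g' w)"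
    using assms unfolding tile_span_mod_def by blast
  from tile_span_diff[OF this] show ?thesis
    unfolding tile_span_mod_def by (intro exI[of _ "\<lambda>w. g w - g' w"]) (simp add: algebra_simps)
qed

lemma tile_span_mod_multiple: "tile_span_mod h n (\<lambda>w. h * g w)"
  unfolding tile_span_mod_def by (intro exI[of _ g]) (simp add: tile_span_0)

lemma tile_span_mod_0: "tile_span_mod h n (\<lambda>w. 0)"
  using tile_span_mod_multiple[of h n "\<lambda>w. 0"] by simp

lemma tile_span_mod_add:
  assumes "tile_span_mod h n \<phi>" "tile_span_mod h n \<psi>"
  shows "tile_span_mod h n (\<lambda>w. \<phi> w + \<psi> w)"
  using tile_span_mod_diff[OF assms(1) tile_span_mod_diff[OF tile_span_mod_0 assms(2)]] by simp

lemma tile_span_mod_sum: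
  "(\<And>i. i \<in> I \<Longrightarrow> tile_span_mod h n (\<phi> i)) \<Longrightarrow> tile_span_mod h n (\<lambda>w. \<Sum>i\<in>I. \<phi> i w)"
  by (induction I rule: infinite_finite_induct) (auto intro: tile_span_mod_0 tile_span_mod_add)

text \<open>Comparing the edges from \<open>j\<close> and from \<open>j + 2\<close> to
  \<open>j + 1\<close> shows that \<alpha> at \<open>j\<close> and at \<open>j + 2\<close> agree
  modulo tiles and \<open>h\<close>. Each parity class has \<open>h\<close> members, so the sum is
  congruent to a multiple of \<open>h\<close>, hence to 0.\<close>

lemma tile_span_mod_path_sum:
  fixes h :: nat
  assumes adj: "\<And>i j. (i, j) \<in> parcs (path_graph (2 * h)) \<Longrightarrow> tile_span_mod h n (\<lambda>w. \<alpha> i w + \<beta> j w)"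
  shows "tile_span_mod h n (\<lambda>w. \<Sum>j<2 * h. \<alpha> j w)"
proof -
  have step: "tile_span_mod h n (\<lambda>w. \<alpha> (Suc (Suc j)) w - \<alpha> j w)" if "Suc (Suc j) < 2 * h" for j
    using tile_span_mod_diff[OF adj[of "Suc (Suc j)" "Suc j"] adj[of j "Suc j"]] that
    by (simp add: path_graph_def)
  have par: "tile_span_mod h n (\<lambda>w. \<alpha> (2 * r + b) w - \<alpha> b w)" if "r < h" "b < 2" for r b
    using that(1)
  proof (induction r)
    case (Suc r)
    then have "tile_span_mod h n (\<lambda>w. \<alpha> (2 * r + b) w - \<alpha> b w)" by simp
    from tile_span_mod_add[OF step[of "2 * r + b"] this] show ?case using Suc.prems that(2) by simp
  qed (simp add: tile_span_mod_0)
  have "(\<Sum>j<2 * m. \<alpha> j w) = (\<Sum>r<m. \<alpha> (2 * r) w + \<alpha> (2 * r + 1) w)" for m w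
    by (induction m) simp_all
  then have "(\<Sum>j<2 * h. \<alpha> j w) =
      (\<Sum>r<h. (\<alpha> (2 * r + 0) w - \<alpha> 0 w) + (\<alpha> (2 * r + 1) w - \<alpha> 1 w)) + int h * (\<alpha> 0 w + \<alpha> 1 w)" for w
    by (simp add: sum.distrib sum_subtractf algebra_simps)
  moreover have "tile_span_mod h n (\<lambda>w. (\<Sum>r<h. (\<alpha> (2 * r + 0) w - \<alpha> 0 w) + (\<alpha> (2 * r + 1) w - \<alpha> 1 w)) + int h * (\<alpha> 0 w + \<alpha> 1 w))"
    by (intro tile_span_mod_add tile_span_mod_sum tile_span_mod_multiple par) auto
  ultimately show ?thesis by simp
qed

end

section \<open>Copies of a set of cube vertices\<close>

text \<open>The pair \<open>p\<close> is an oriented edge of the path on which the corresponding coordinate is placed.\<close>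

definition embed :: "(nat \<times> nat) list \<Rightarrow> nat list \<Rightarrow> nat list" where
  "embed ps xs = map2 (\<lambda>p x. if x = 0 then fst p else snd p) ps xs"

lemma embed_simps [simp]:
  "embed [] xs = []" "embed ps [] = []"
  "embed (p # ps) (x # xs) = (if x = 0 then fst p else snd p) # embed ps xs"
  by (simp_all add: embed_def)

lemma inj_on_embed:
  "set ps \<subseteq> parcs (path_graph m) \<Longrightarrow> inj_on (embed ps) (words {0, 1} (length ps))"
proof (induction ps)
  case (Cons p ps)
  then have "fst p \<noteq> snd p" by (auto simp: path_graph_def)
  with Cons show ?case by (auto simp: inj_on_def words_def length_Suc_conv split: if_splits)
qed (auto simp: inj_on_def)

lemma embed_words:
  "length xs = length ps \<Longrightarrow> set ps \<subseteq> parcs (path_graph m) \<Longrightarrow> embed ps xs \<in> words {..<m} (length ps)"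
  by (induction xs ps rule: list_induct2) (auto simp: words_def path_graph_def)

text \<open>The other end of the edge {2r, 2r+1} containing \<open>i\<close>; these edges partition
  the path.\<close>

definition mate :: "nat \<Rightarrow> nat" where
  "mate i = (if even i then Suc i else i - 1)"

lemma adjacent_same_pair_iff: "(j = Suc i \<or> i = Suc j) \<and> i div 2 = j div 2 \<longleftrightarrow> j = mate i"
proof (cases "even i")
  case True
  then obtain r where "i = 2 * r" by (elim evenE)
  then show ?thesis by (auto simp: mate_def)
next
  case False
  then obtain r where "i = 2 * r + 1" by (elim oddE)
  then show ?thesis by (auto simp: mate_def)
qed

lemma mate_mate: "mate (mate i) = i"
  by (cases "even i") (auto simp: mate_def elim!: oddE)

lemma mate_less: "i < 2 * h \<Longrightarrow> mate i < 2 * h"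
  by (auto simp: mate_def elim!: evenE)

section \<open>The constant 1 as a combination of placed copies modulo \<open>h\<close>\<close>

text \<open>\<open>A\<close> is the vertex set of a copy of the graph in the \<open>k\<close>-cube.
  Every choice of an oriented path edge per coordinate must give a tile; reversing an edge reflects
  the cube.\<close>

locale cube_tiling = tiling "{..<2 * h}" tiles for h :: nat and tiles +
  fixes k :: nat and A :: "nat list set"
  assumes A_bits: "A \<subseteq> words {0, 1} k" and A_card: "card A = h" and A_nonempty: "A \<noteq> {}"
    and embed_tile: "length ps = k \<Longrightarrow> set ps \<subseteq> parcs (path_graph (2 * h)) \<Longrightarrow>
      embed ps ` A \<in> tiles \<and> embed ps ` A \<subseteq> words {..<2 * h} k"
begin

text \<open>\<open>B\<close> constrains the last \<open>m\<close> letters, while the first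
  \<open>i\<close> are free. Summing over the letter at position \<open>i\<close> with
  \<open>tile_span_mod_path_sum\<close> frees it too and passes to a section of \<open>B\<close>; at
  \<open>m = 0\<close> only \<open>{[]}\<close> is left, whose indicator is 1.\<close>

lemma tile_span_mod_one_aux:
  assumes "B \<subseteq> words {0, 1} m" "B \<noteq> {}"
    and "\<And>ps. length ps = m \<Longrightarrow> set ps \<subseteq> parcs (path_graph (2 * h)) \<Longrightarrow>
      tile_span_mod h (i + m) (\<lambda>w. of_bool (drop i w \<in> embed ps ` B))"
  shows "tile_span_mod h (i + m) (\<lambda>w. 1)"
  using assms
proof (induction m arbitrary: i B)
  case 0
  then have "B = {[]}" by auto
  then show ?case using 0(3)[of "[]"] by (auto elim!: tile_span_mod_cong simp: words_def)
next
  case (Suc m)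
  define C where "C x = {b. x # b \<in> B}" for x
  have C: "C x \<subseteq> words {0, 1} m" for x
  proof
    fix b assume "b \<in> C x"
    then have "x # b \<in> words {0, 1} (Suc m)" using Suc.prems(1) by (auto simp: C_def)
    then show "b \<in> words {0, 1} m" by (simp add: words_def)
  qed
  define \<alpha> where "\<alpha> x ps j w = (of_bool (w ! i = j \<and> drop (Suc i) w \<in> embed ps ` C x) :: int)"
    for x ps j and w :: "nat list"
  have drop: "drop i w = w ! i # drop (Suc i) w" "w ! i < 2 * h" if "w \<in> W (i + Suc m)" for w
  proof -
    have "i < length w" using that by (simp add: words_def)
    then show "drop i w = w ! i # drop (Suc i) w" by (simp add: Cons_nth_drop_Suc)
    have "w ! i \<in> set w" using \<open>i < length w\<close> by (rule nth_mem)
    then show "w ! i < 2 * h" using that unfolding words_def by blast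
  qed
  have edge: "tile_span_mod h (i + Suc m) (\<lambda>w. \<alpha> 0 ps p w + \<alpha> 1 ps q w)"
    if ps: "length ps = m" "set ps \<subseteq> parcs (path_graph (2 * h))" and pq: "(p, q) \<in> parcs (path_graph (2 * h))" for ps p q
  proof (rule tile_span_mod_cong)
    show "tile_span_mod h (i + Suc m) (\<lambda>w. of_bool (drop i w \<in> embed ((p, q) # ps) ` B))"
      using ps pq by (intro Suc.prems) auto
    fix w assume w: "w \<in> W (i + Suc m)"
    have B: "B = (#) 0 ` C 0 \<union> (#) 1 ` C 1"
      using Suc.prems(1) by (force simp: C_def words_def length_Suc_conv)
    have "drop i w \<in> embed ((p, q) # ps) ` B \<longleftrightarrow>
      w ! i = p \<and> drop (Suc i) w \<in> embed ps ` C 0 \<or> w ! i = q \<and> drop (Suc i) w \<in> embed ps ` C 1"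
      unfolding B image_Un image_image drop(1)[OF w] by auto
    moreover have "p \<noteq> q" using pq by (auto simp: path_graph_def)
    ultimately show "of_bool (drop i w \<in> embed ((p, q) # ps) ` B) = \<alpha> 0 ps p w + \<alpha> 1 ps q w"
      by (auto simp: \<alpha>_def)
  qed
  have sym: "(q, p) \<in> parcs (path_graph (2 * h))" if "(p, q) \<in> parcs (path_graph (2 * h))" for p q
    using that by (auto simp: path_graph_def)
  \<comment> \<open>The bit \<open>x\<close> is chosen with \<open>C x\<close> nonempty, so that the
    recursion ends at \<open>{[]}\<close> and not at the empty set.\<close>
  obtain b where b: "b \<in> B" using Suc.prems(2) by blast
  then have "b \<in> words {0, 1} (Suc m)" using Suc.prems(1) by blast
  then obtain x b' where "b = x # b'" "x \<in> {0, 1}" by (cases b) (auto simp: words_def)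
  with b have x: "x \<in> {0, 1}" "C x \<noteq> {}" by (auto simp: C_def)
  have "tile_span_mod h (Suc i + m) (\<lambda>w. 1)"
  proof (rule Suc.IH[OF C x(2)])
    fix ps :: "(nat \<times> nat) list" assume ps: "length ps = m" "set ps \<subseteq> parcs (path_graph (2 * h))"
    have "tile_span_mod h (i + Suc m) (\<lambda>w. \<Sum>j<2 * h. \<alpha> x ps j w)"
    proof (cases "x = 0")
      case True
      then show ?thesis using edge[OF ps] by (intro tile_span_mod_path_sum[where \<beta> = "\<alpha> 1 ps"]) simp
    next
      case False
      \<comment> \<open>For \<open>x = 1\<close> the edge is used in reverse, with the section
        \<open>C 0\<close> as companion.\<close>
      then show ?thesis using x(1) edge[OF ps sym]
        by (intro tile_span_mod_path_sum[where \<beta> = "\<alpha> 0 ps"]) (simp add: add.commute)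
    qed
    then have "tile_span_mod h (i + Suc m) (\<lambda>w. of_bool (drop (Suc i) w \<in> embed ps ` C x))"
    proof (rule tile_span_mod_cong)
      fix w assume "w \<in> W (i + Suc m)"
      from drop(2)[OF this]
      show "(\<Sum>j<2 * h. \<alpha> x ps j w) = of_bool (drop (Suc i) w \<in> embed ps ` C x)"
        by (auto simp: \<alpha>_def of_bool_def)
    qed
    then show "tile_span_mod h (Suc i + m) (\<lambda>w. of_bool (drop (Suc i) w \<in> embed ps ` C x))" by simp
  qed
  then show ?case by simp
qed

lemma tile_span_mod_one: "tile_span_mod h k (\<lambda>w. 1)"
proof -
  have "tile_span_mod h (0 + k) (\<lambda>w. 1)"
  proof (rule tile_span_mod_one_aux[OF A_bits A_nonempty])
    fix ps :: "(nat \<times> nat) list" assume "length ps = k" "set ps \<subseteq> parcs (path_graph (2 * h))"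
    then have "tile_span k (\<lambda>w. of_bool (w \<in> embed ps ` A))"
      using embed_tile by (intro tile_span_tile) auto
    then show "tile_span_mod h (0 + k) (\<lambda>w. of_bool (drop 0 w \<in> embed ps ` A))"
      unfolding tile_span_mod_def by (intro exI[of _ "\<lambda>w. 0"]) simp
  qed
  then show ?thesis by simp
qed

section \<open>The constant \<open>h\<close> as a sum of placed copies\<close>

text \<open>A list of length \<open>k\<close> over \<open>pairs\<close> names a cube of a partition
  into \<open>k\<close>-cubes together with a reflection of it.\<close>

definition pairs :: "(nat \<times> nat) set" where
  "pairs = {(i, j) \<in> parcs (path_graph (2 * h)). i div 2 = j div 2}"

lemma pairs_iff: "(i, j) \<in> pairs \<longleftrightarrow> i < 2 * h \<and> j = mate i"
  using adjacent_same_pair_iff[of j i] mate_less[of i h] by (auto simp: pairs_def path_graph_def)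

lemma pairs_iff': "(i, j) \<in> pairs \<longleftrightarrow> j < 2 * h \<and> i = mate j"
  using mate_mate mate_less by (auto simp: pairs_iff)

text \<open>Each letter of \<open>w\<close> determines its pair, and the bit of \<open>a\<close>
  says which end of it the letter must be, which fixes the orientation.\<close>

lemma embed_unique:
  assumes "length a = length w" "set a \<subseteq> {0, 1}" "set w \<subseteq> {..<2 * h}"
  shows "\<exists>!ps. length ps = length w \<and> set ps \<subseteq> pairs \<and> embed ps a = w"
  using assms
proof (induction a w rule: list_induct2)
  case (Cons x a y w)
  then have "\<exists>!ps. length ps = length w \<and> set ps \<subseteq> pairs \<and> embed ps a = w" by simp
  then obtain ps where ps: "length ps = length w \<and> set ps \<subseteq> pairs \<and> embed ps a = w"
    and uniq: "\<And>ps'. length ps' = length w \<and> set ps' \<subseteq> pairs \<and> embed ps' a = w \<Longrightarrow> ps' = ps"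
    by (rule ex1E) blast
  define p where "p = (if x = 0 then (y, mate y) else (mate y, y))"
  have y: "y < 2 * h" using Cons.prems by simp
  have p: "p \<in> pairs" "(if x = 0 then fst p else snd p) = y"
    using y pairs_iff[of y] pairs_iff'[of _ y] by (simp_all add: p_def)
  have pu: "p' = p" if "p' \<in> pairs" "(if x = 0 then fst p' else snd p') = y" for p'
  proof (cases "x = 0")
    case True
    then show ?thesis using that by (cases p') (simp add: p_def pairs_iff)
  next
    case False
    then show ?thesis using that by (cases p') (simp add: p_def pairs_iff')
  qed
  show ?case
  proof (rule ex1I[of _ "p # ps"])
    show "length (p # ps) = length (y # w) \<and> set (p # ps) \<subseteq> pairs \<and> embed (p # ps) (x # a) = y # w"
      using ps p by simp
    fix qs assume "length qs = length (y # w) \<and> set qs \<subseteq> pairs \<and> embed qs (x # a) = y # w"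
    then show "qs = p # ps" using pu uniq by (cases qs) simp_all
  qed
qed auto

text \<open>Double counting over the placements along \<open>pairs\<close>: for each
  \<open>a\<close> in \<open>A\<close> exactly one placement sends \<open>a\<close> to
  \<open>w\<close>, so every word is covered \<open>card A = h\<close> times.\<close>

lemma tile_span_card: "tile_span k (\<lambda>w. int h)"
proof -
  let ?L = "{ps. set ps \<subseteq> pairs \<and> length ps = k}"
  have "finite pairs"
    by (rule finite_subset[of _ "{..<2 * h} \<times> {..<2 * h}"]) (auto simp: pairs_def path_graph_def)
  then have fin: "finite ?L" by (rule finite_lists_length_eq)
  have "finite A" using A_bits by (rule finite_subset) (simp add: finite_words)
  have "tile_span k (\<lambda>w. \<Sum>ps\<in>?L. of_bool (w \<in> embed ps ` A))"
  proof (intro tile_span_sum tile_span_tile)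
    fix ps assume "ps \<in> ?L"
    then have "length ps = k" "set ps \<subseteq> parcs (path_graph (2 * h))" by (auto simp: pairs_def)
    from embed_tile[OF this] show "embed ps ` A \<in> tiles" "embed ps ` A \<subseteq> W k" by auto
  qed
  then show ?thesis
  proof (rule tile_span_cong)
    fix w assume w: "w \<in> W k"
    have "of_bool (w \<in> embed ps ` A) = (\<Sum>a\<in>A. of_bool (embed ps a = w) :: int)" if "ps \<in> ?L" for ps
    proof (cases "w \<in> embed ps ` A")
      case True
      then obtain a where a: "a \<in> A" "embed ps a = w" by blast
      have "inj_on (embed ps) A" using inj_on_embed[of ps "2 * h"] that A_bits
        by (auto simp: pairs_def intro: inj_on_subset)
      then have "embed ps b = w \<longleftrightarrow> b = a" if "b \<in> A" for b using a that by (auto dest: inj_onD)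
      then have "(\<Sum>b\<in>A. of_bool (embed ps b = w) :: int) = (\<Sum>b\<in>A. of_bool (b = a))"
        by (intro sum.cong) auto
      then show ?thesis using True a \<open>finite A\<close> by (simp add: of_bool_def)
    next
      case False
      then have "embed ps a \<noteq> w" if "a \<in> A" for a using that by blast
      then show ?thesis using False by simp
    qed
    then have "(\<Sum>ps\<in>?L. of_bool (w \<in> embed ps ` A)) = (\<Sum>ps\<in>?L. \<Sum>a\<in>A. of_bool (embed ps a = w) :: int)"
      by simp
    also have "\<dots> = (\<Sum>a\<in>A. \<Sum>ps\<in>?L. of_bool (embed ps a = w))" by (rule sum.swap)
    also have "\<dots> = (\<Sum>a\<in>A. 1)"
    proof (rule sum.cong)
      fix a assume "a \<in> A"
      then have "\<exists>!ps. length ps = length w \<and> set ps \<subseteq> pairs \<and> embed ps a = w"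
        using A_bits w by (intro embed_unique) (auto simp: words_def)
      then obtain qs where qs': "length qs = length w \<and> set qs \<subseteq> pairs \<and> embed qs a = w"
        and uniq: "\<And>ps. length ps = length w \<and> set ps \<subseteq> pairs \<and> embed ps a = w \<Longrightarrow> ps = qs"
        by (rule ex1E) blast
      have qs: "qs \<in> ?L" "embed qs a = w" using w qs' by (simp_all add: words_def)
      have "of_bool (embed ps a = w) = (of_bool (ps = qs) :: int)" if "ps \<in> ?L" for ps
      proof (cases "embed ps a = w")
        case True
        have "ps = qs" by (rule uniq) (use True that w in \<open>simp add: words_def\<close>)
        then show ?thesis using True by simp
      qed (use qs(2) in auto)
      then have "(\<Sum>ps\<in>?L. of_bool (embed ps a = w) :: int) = (\<Sum>ps\<in>?L. of_bool (ps = qs))"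
        by (rule sum.cong[OF refl])
      also have "\<dots> = 1" using fin qs(1) by (simp only: of_bool_def sum.delta) simp
      finally show "(\<Sum>ps\<in>?L. of_bool (embed ps a = w)) = (1 :: int)" .
    qed simp
    finally show "(\<Sum>ps\<in>?L. of_bool (w \<in> embed ps ` A)) = int h" by (simp add: A_card)
  qed
qed

theorem tileable_path_powers: "\<exists>N. \<forall>n\<ge>N. tileable (W n)"
proof -
  obtain g where "tile_span k (\<lambda>w. 1 - int h * g w)"
    using tile_span_mod_one unfolding tile_span_mod_def by blast
  from tileable_words_of_tile_span[OF tile_span_one[OF this tile_span_card]] show ?thesis .
qed

end

section \<open>Induced copies in powers of a path\<close>

lemma digraph_iso_induce_image:
  fixes G :: "'a pair_pre_digraph" and G' :: "'b pair_pre_digraph"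
  assumes inj: "inj_on f T"
    and arcs: "\<And>x y. x \<in> T \<Longrightarrow> y \<in> T \<Longrightarrow> (f x, f y) \<in> parcs G' \<longleftrightarrow> (x, y) \<in> parcs G"
  shows "digraph_iso (with_proj G \<restriction> T) (with_proj G' \<restriction> f ` T)"
proof -
  let ?hom = "\<lparr>iso_verts = f, iso_arcs = map_prod f f, iso_head = snd, iso_tail = fst\<rparr>"
  have "pre_digraph.digraph_isomorphism (with_proj G \<restriction> T) ?hom"
    unfolding pre_digraph.digraph_isomorphism_def
  proof (intro conjI ballI)
    show "wf_digraph (with_proj G \<restriction> T)" by unfold_locales auto
    have "inj_on (map_prod f f) (T \<times> T)" using inj by (rule map_prod_inj_on) (rule inj)
    then show "inj_on (iso_arcs ?hom) (arcs (with_proj G \<restriction> T))"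
      by (rule_tac inj_on_subset) auto
  qed (use inj in auto)
  moreover have "{e \<in> parcs G'. fst e \<in> f ` T \<and> snd e \<in> f ` T} =
      map_prod f f ` {e \<in> parcs G. fst e \<in> T \<and> snd e \<in> T}" (is "?L = ?R")
  proof
    show "?L \<subseteq> ?R"
    proof
      fix e assume e: "e \<in> ?L"
      then obtain x y where xy: "x \<in> T" "y \<in> T" "e = (f x, f y)" by (cases e) auto
      then have "(x, y) \<in> parcs G" using e arcs by auto
      then show "e \<in> ?R" using xy by (intro image_eqI[of _ _ "(x, y)"]) auto
    qed
  qed (use arcs in auto)
  then have "with_proj G' \<restriction> f ` T = app_iso ?hom (with_proj G \<restriction> T)"
    unfolding app_iso_def induce_subgraph_def by simp
  ultimately show ?thesis unfolding digraph_iso_def by blast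
qed

text \<open>As \<open>G\<close> has no loops, an edge cannot move along a shared letter of the
  prefix or suffix; hence padding a tile with fixed coordinates gives a tile again.\<close>

lemma parcs_cart_power_append:
  assumes "pair_graph G" "length x = length y" "set x \<subseteq> pverts G" "set y \<subseteq> pverts G" "set u \<subseteq> pverts G" "set v \<subseteq> pverts G"
  shows "(u @ x @ v, u @ y @ v) \<in> parcs (cart_power G (length u + length x + length v)) \<longleftrightarrow>
    (x, y) \<in> parcs (cart_power G (length x))"
proof -
  interpret G: pair_graph G by fact
  have suf: "(x @ v, y @ v) \<in> parcs (cart_power G (length x + length v)) \<longleftrightarrow>
      (x, y) \<in> parcs (cart_power G (length x))"
    using assms(2-4)
  proof (induction x y rule: list_induct2)
    case Nil
    interpret pair_graph "cart_power G (length v)" by (rule pair_graph_cart_power[OF assms(1)])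
    show ?case using no_loops' by auto
  next
    case (Cons a x b y)
    then show ?case
      using assms(6) by (simp add: parcs_cart_power_Suc pverts_cart_power del: cart_power.simps)
  qed
  show ?thesis using assms(5)
  proof (induction u)
    case (Cons a u)
    moreover have "(a, a) \<notin> parcs G" using G.no_loops' by blast
    ultimately show ?case using assms
      by (auto simp add: parcs_cart_power_Suc pverts_cart_power simp del: cart_power.simps)
  qed (simp add: suf)
qed

text \<open>Each coordinate sends 0 and 1 to the two ends of an edge, which induce a copy of the
  path on two vertices; with the cube viewed as a power of that path, adjacency is compared
  coordinate by coordinate.\<close>

lemma parcs_cart_power_embed:
  assumes "length x = length ps" "length y = length ps" "set x \<subseteq> {0, 1}" "set y \<subseteq> {0, 1}"
    and "set ps \<subseteq> parcs (path_graph m)"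
  shows "(embed ps x, embed ps y) \<in> parcs (cart_power (path_graph m) (length ps)) \<longleftrightarrow>
    (x, y) \<in> parcs (hypercube (length ps))"
  unfolding cart_power_path_graph_2[symmetric] using assms
proof (induction ps arbitrary: x y)
  case (Cons p ps)
  then obtain a x' b y' where eq: "x = a # x'" "y = b # y'" by (metis length_Suc_conv)
  define c where "c a = (if a = 0 then fst p else snd p)" for a :: nat
  have p: "(fst p, snd p) \<in> parcs (path_graph m)" using Cons.prems(5) by simp
  have ps: "set ps \<subseteq> parcs (path_graph m)" using Cons.prems(5) by simp
  have ab: "a \<in> {0, 1}" "b \<in> {0, 1}" using Cons.prems(3,4) eq by auto
  have x'y': "x' \<in> words {0, 1} (length ps)" "y' \<in> words {0, 1} (length ps)"
    using Cons.prems(1-4) eq by (auto simp: words_def)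
  then have len: "length x' = length ps" "length y' = length ps" by (auto simp: words_def)
  have IH: "(embed ps x', embed ps y') \<in> parcs (cart_power (path_graph m) (length ps)) \<longleftrightarrow>
      (x', y') \<in> parcs (cart_power (path_graph 2) (length ps))"
    using Cons.prems(3-5) eq len by (intro Cons.IH) auto
  have "c a = c b \<longleftrightarrow> a = b" "(c a, c b) \<in> parcs (path_graph m) \<longleftrightarrow> (a, b) \<in> parcs (path_graph 2)"
    "c a \<in> pverts (path_graph m)" "c b \<in> pverts (path_graph m)"
    "a \<in> pverts (path_graph 2)" "b \<in> pverts (path_graph 2)"
    using p ab by (auto simp: path_graph_def c_def)
  moreover have "embed ps x' = embed ps y' \<longleftrightarrow> x' = y'"
    using inj_on_embed[OF ps] x'y' by (auto dest: inj_onD)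
  moreover have "embed ps x' \<in> pverts (cart_power (path_graph m) (length ps))"
    "embed ps y' \<in> pverts (cart_power (path_graph m) (length ps))"
    using embed_words[OF len(1) ps] embed_words[OF len(2) ps]
    by (simp_all add: pverts_cart_power words_def path_graph_def)
  moreover have "x' \<in> pverts (cart_power (path_graph 2) (length ps))"
    "y' \<in> pverts (cart_power (path_graph 2) (length ps))"
    using x'y' by (auto simp: pverts_cart_power words_def path_graph_def)
  ultimately show ?case
    unfolding eq embed_simps length_Cons parcs_cart_power_Suc c_def[symmetric] IH by simp
qed simp

theorem theorem3:
  fixes H :: "('a, 'b) pre_digraph"
  assumes "graph H"
    and "\<exists>k I. induced_subgraph I (with_proj (hypercube k)) \<and> digraph_iso H I"
  shows "\<exists>N. \<forall>n\<ge>N. has_perfect_induced_packing H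
           (with_proj (cart_power (path_graph (2 * card (verts H))) n))"
proof -
  interpret H: graph H by fact
  define h where "h = card (verts H)"
  define G where "G = cart_power (path_graph (2 * h))"
  have verts_G: "pverts (G n) = words {..<2 * h} n" for n
    by (simp add: G_def pverts_cart_power words_def path_graph_def)
  have "\<exists>N. \<forall>n\<ge>N. has_perfect_induced_packing H (with_proj (G n))"
  proof (cases "h = 0")
    case True
    \<comment> \<open>The zeroth power has one vertex even for the empty path, so the bound is
      1.\<close>
    then have "pverts (G n) = {}" if "n \<ge> 1" for n using that by (auto simp: verts_G words_def)
    then show ?thesis unfolding has_perfect_induced_packing_def
      by (intro exI[of _ 1] allI impI exI[of _ "{}"]) (simp add: partition_on_empty)
  next
    case False
    from assms(2) obtain k I where I: "induced_subgraph I (with_proj (hypercube k))" "digraph_iso H I"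
      by blast
    define A where "A = verts I"
    have A: "A \<subseteq> words {0, 1} k"
      using I(1) by (auto simp: A_def induced_subgraph_def subgraph_def hypercube_def words_def)
    have I_eq: "I = with_proj (hypercube k) \<restriction> A"
      using I(1) unfolding induced_subgraph_def subgraph_def compatible_def induce_subgraph_def A_def
      by (intro pre_digraph.equality) auto
    have card_A: "card A = h"
      using I(2) unfolding digraph_iso_def A_def h_def
      by (auto simp: H.digraph_isomorphism_inj_on_verts intro!: card_image)
    \<comment> \<open>Copies in all dimensions are collected at once, since translation changes the
      dimension.\<close>
    define tiles where "tiles = {T. T \<noteq> {} \<and> (\<exists>n. T \<subseteq> words {..<2 * h} n \<and> digraph_iso H (with_proj (G n) \<restriction> T))}"
    interpret cube_tiling h tiles k A
    proof
      show "finite {..<2 * h}" "{} \<notin> tiles" "\<And>T. T \<in> tiles \<Longrightarrow> \<exists>n. T \<subseteq> words {..<2 * h} n"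
        by (auto simp: tiles_def)
      show "A \<subseteq> words {0, 1} k" "card A = h" by fact+
      show "A \<noteq> {}" using card_A False by auto
    next
      fix T u v assume T: "T \<in> tiles" and uv: "u \<in> lists {..<2 * h}" "v \<in> lists {..<2 * h}"
      from T obtain n where n: "T \<subseteq> words {..<2 * h} n" "digraph_iso H (with_proj (G n) \<restriction> T)" "T \<noteq> {}"
        by (auto simp: tiles_def)
      let ?f = "\<lambda>w. u @ w @ v" and ?n = "length u + n + length v"
      have "digraph_iso (with_proj (G n) \<restriction> T) (with_proj (G ?n) \<restriction> ?f ` T)"
      proof (rule digraph_iso_induce_image)
        fix x y assume "x \<in> T" "y \<in> T"
        then have "x \<in> words {..<2 * h} n" "y \<in> words {..<2 * h} n" using n(1) by auto
        then show "(?f x, ?f y) \<in> parcs (G ?n) \<longleftrightarrow> (x, y) \<in> parcs (G n)"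
          using parcs_cart_power_append[OF pair_graph_path_graph, of x y "2 * h" u v] uv
          by (auto simp: words_def G_def path_graph_def lists_eq_set)
      qed (simp add: inj_on_def)
      with n(2) have "digraph_iso H (with_proj (G ?n) \<restriction> ?f ` T)" by (rule digraph_iso_trans)
      moreover have "?f x \<in> words {..<2 * h} ?n" if "x \<in> words {..<2 * h} n" for x
        using that uv by (auto simp: words_def lists_eq_set)
      then have "?f ` T \<subseteq> words {..<2 * h} ?n" using n(1) by blast
      ultimately show "?f ` T \<in> tiles" unfolding tiles_def using n(3) by blast
    next
      fix ps :: "(nat \<times> nat) list" assume ps: "length ps = k" "set ps \<subseteq> parcs (path_graph (2 * h))"
      have "inj_on (embed ps) A" using inj_on_embed[OF ps(2)] ps(1) A by (auto intro: inj_on_subset)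
      moreover have "(embed ps x, embed ps y) \<in> parcs (G k) \<longleftrightarrow> (x, y) \<in> parcs (hypercube k)"
        if "x \<in> A" "y \<in> A" for x y
      proof -
        have "x \<in> words {0, 1} k" "y \<in> words {0, 1} k" using that A by auto
        then show ?thesis
          using parcs_cart_power_embed[of x ps y "2 * h"] ps by (simp add: words_def G_def)
      qed
      ultimately have "digraph_iso I (with_proj (G k) \<restriction> embed ps ` A)"
        unfolding I_eq by (rule digraph_iso_induce_image)
      with I(2) have "digraph_iso H (with_proj (G k) \<restriction> embed ps ` A)" by (rule digraph_iso_trans)
      moreover have "embed ps x \<in> words {..<2 * h} k" if "x \<in> words {0, 1} k" for x
        using embed_words[of x ps] ps that by (auto simp: words_def)
      then have "embed ps ` A \<subseteq> words {..<2 * h} k" using A by blast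
      moreover have "embed ps ` A \<noteq> {}" using card_A False by auto
      ultimately show "embed ps ` A \<in> tiles \<and> embed ps ` A \<subseteq> words {..<2 * h} k"
        unfolding tiles_def by blast
    qed
    obtain N where N: "\<And>n. n \<ge> N \<Longrightarrow> tileable (words {..<2 * h} n)"
      using tileable_path_powers by blast
    have "has_perfect_induced_packing H (with_proj (G n))" if n: "n \<ge> N" for n
    proof -
      obtain P where P: "partition_on (words {..<2 * h} n) P" "P \<subseteq> tiles"
        using N[OF n] unfolding tileable_def by blast
      have "digraph_iso H (with_proj (G n) \<restriction> S)" if "S \<in> P" for S
      proof -
        \<comment> \<open>A priori the copy sits in some other power; a word of the nonempty
          \<open>S\<close> has length both \<open>m\<close> and \<open>n\<close>.\<close>
        have "S \<in> tiles" using that P(2) by blast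
        then obtain m where m: "S \<subseteq> words {..<2 * h} m" "digraph_iso H (with_proj (G m) \<restriction> S)" and "S \<noteq> {}"
          by (auto simp: tiles_def)
        then obtain w where "w \<in> S" by blast
        then have "w \<in> words {..<2 * h} m" "w \<in> words {..<2 * h} n"
          using m(1) that partition_onD1[OF P(1)] by auto
        then have "m = n" by (simp add: words_def)
        then show ?thesis using m(2) by simp
      qed
      then show ?thesis
        unfolding has_perfect_induced_packing_def using P(1) by (auto simp: verts_G)
    qed
    then show ?thesis by blast
  qed
  then show ?thesis by (simp add: G_def h_def)
qed

end
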